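(* Let $\mathcal{R}$ be the set of real numbers $q$ such that $\mathrm{Rel}(G;q)=0$ for some connected simple graph $G$. Then the topological closure of $\mathcal{R}$ in $\mathbb{R}$ is $\overline{\mathcal{R}}=[-1,0]\cup\{1\}$.
   Context: For a connected finite graph $G$ with vertex set $V(G)$ and edge set $E(G)$, the all-terminal reliability polynomial is $\mathrm{Rel}(G;q)=\sum_{A}(1-q)^{|A|}q^{|E(G)|-|A|}$, where the sum runs over all subsets $A\subseteq E(G)$ such that the spanning subgraph $(V(G),A)$ is connected. A real root of $\mathrm{Rel}(G;q)$ is called a real reliability root of $G$. *)

theory Defs
  imports "HOL-Analysis.Analysis"
begin

text \<open>A finite simple graph with vertex set V (natural numbers) and edge set E,
each edge being a 2-element subset of V.\<close>
definition simple_graph :: "nat set \<Rightarrow> nat set set \<Rightarrow> bool" where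
  "simple_graph V E \<longleftrightarrow> finite V \<and> (\<forall>e\<in>E. e \<subseteq> V \<and> card e = 2)"

text \<open>The spanning subgraph (V, A) is connected: any two vertices are joined by a walk in A.\<close>
definition spanning_connected :: "nat set \<Rightarrow> nat set set \<Rightarrow> bool" where
  "spanning_connected V A \<longleftrightarrow>
     (\<forall>u\<in>V. \<forall>v\<in>V. (u, v) \<in> {(x, y). {x, y} \<in> A}\<^sup>*)"

definition connected_graph :: "nat set \<Rightarrow> nat set set \<Rightarrow> bool" where
  "connected_graph V E \<longleftrightarrow> V \<noteq> {} \<and> spanning_connected V E"

text \<open>All-terminal reliability polynomial, evaluated at q.\<close>
definition Rel :: "nat set \<Rightarrow> nat set set \<Rightarrow> real \<Rightarrow> real" where
  "Rel V E q = (\<Sum>A\<in>{A. A \<subseteq> E \<and> spanning_connected V A}.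
                  (1 - q) ^ card A * q ^ (card E - card A))"

end

theory Submission
  imports Defs
begin

text \<open>
  Put \<open>y = 1/q\<close> and \<open>v = y - 1\<close>. For \<open>q \<noteq> 0\<close> the reliability is \<open>q ^ card E\<close> times the sum \<open>Z\<close> of
  \<open>v ^ card A\<close> over the connected spanning \<open>A\<close>.

  If \<open>\<bar>y\<bar> < 1\<close>, fix vertices \<open>r \<noteq> x\<close> and expand \<open>Z\<close> over the component \<open>W\<close> of \<open>x\<close> after deleting
  \<open>r\<close>: each term is \<open>Z(W) (y^k - 1) Z(V - W)\<close>, where \<open>k\<close> is the number of edges from \<open>r\<close> to \<open>W\<close>.
  By induction \<open>Z\<close> has the sign \<open>(-1) ^ (card V - 1)\<close>, so there is no root with \<open>\<bar>q\<bar> > 1\<close>. For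
  \<open>0 < q < 1\<close> all summands are positive.

  For density, glue \<open>N\<close> copies of a complete graph on \<open>n\<close> vertices into a chain and join its ends
  by an edge. With \<open>C\<close> the connected sum of the complete graph and \<open>S\<close> its sum over subsets with
  exactly two components, separating two terminals, \<open>Z = C^(N-1) (y C + (y - 1) N S)\<close>. For fixed
  \<open>\<bar>y\<bar> > 1\<close> and \<open>n\<close> tending to infinity, \<open>S/C\<close> is asymptotic to \<open>2 y^(1-n)\<close>, so for even \<open>n\<close> and
  \<open>N\<close> about \<open>b^n\<close> the second factor changes sign near \<open>y = -b\<close>, for any \<open>b > 1\<close>.
\<close>

section \<open>Connectivity\<close>

text \<open>Closed vertex sets replace walks in the connectivity arguments: no edge of
  \<open>A\<close> leaves a closed set, so a disconnection is witnessed by a closed set that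
  contains one vertex and misses another.\<close>

definition adj_closed :: "nat set set \<Rightarrow> nat set \<Rightarrow> bool" where
  "adj_closed A U \<longleftrightarrow> (\<forall>x y. {x, y} \<in> A \<longrightarrow> x \<in> U \<longrightarrow> y \<in> U)"

definition component :: "nat set set \<Rightarrow> nat \<Rightarrow> nat set" where
  "component A u = {z. (u, z) \<in> {(x, y). {x, y} \<in> A}\<^sup>*}"

lemma adj_closedD: "adj_closed A U \<Longrightarrow> {x, y} \<in> A \<Longrightarrow> x \<in> U \<Longrightarrow> y \<in> U"
  unfolding adj_closed_def by blast

lemma component_self [simp]: "u \<in> component A u"
  unfolding component_def by simp

lemma adj_closed_component: "adj_closed A (component A u)"
  unfolding component_def adj_closed_def by (auto intro: rtrancl_into_rtrancl)

lemma component_least: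
  assumes "adj_closed A U" "u \<in> U"
  shows "component A u \<subseteq> U"
proof
  fix z assume "z \<in> component A u"
  then have "(u, z) \<in> {(x, y). {x, y} \<in> A}\<^sup>*" by (simp add: component_def)
  then show "z \<in> U"
    by (induction rule: rtrancl_induct) (use assms in \<open>auto dest: adj_closedD\<close>)
qed

lemma component_mono:
  assumes "A \<subseteq> B"
  shows "component A u \<subseteq> component B u"
proof (rule component_least)
  show "adj_closed A (component B u)"
    using adj_closed_component[of B u] assms unfolding adj_closed_def by blast
qed simp

text \<open>Adjacency is symmetric, so walks from one base vertex can be reversed and
  concatenated.\<close>

lemma spanning_connected_iff_component:
  assumes "u \<in> V"
  shows "spanning_connected V A \<longleftrightarrow> V \<subseteq> component A u"
proof
  assume "spanning_connected V A"
  then show "V \<subseteq> component A u"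
    using assms unfolding spanning_connected_def component_def by blast
next
  assume sub: "V \<subseteq> component A u"
  have "sym {(x, y). {x, y} \<in> A}" by (auto simp: sym_def insert_commute)
  then have "sym ({(x, y). {x, y} \<in> A}\<^sup>*)" by (rule sym_rtrancl)
  then show "spanning_connected V A"
    using sub unfolding spanning_connected_def component_def
    by (metis (no_types, lifting) mem_Collect_eq rtrancl_trans subsetD symD)
qed

text \<open>The component of \<open>u\<close> is the least closed set containing \<open>u\<close>.
  In this form connectivity is proved or refuted by building suitable closed sets.\<close>

lemma spanning_connected_iff:
  assumes "u \<in> V"
  shows "spanning_connected V A \<longleftrightarrow> (\<forall>U. adj_closed A U \<and> u \<in> U \<longrightarrow> V \<subseteq> U)"
proof
  assume "spanning_connected V A"
  then have "V \<subseteq> component A u" using spanning_connected_iff_component[OF assms] by simp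
  then show "\<forall>U. adj_closed A U \<and> u \<in> U \<longrightarrow> V \<subseteq> U"
    using component_least[of A _ u] by (meson order_trans)
next
  assume "\<forall>U. adj_closed A U \<and> u \<in> U \<longrightarrow> V \<subseteq> U"
  then have "V \<subseteq> component A u" using adj_closed_component component_self by simp
  then show "spanning_connected V A" using spanning_connected_iff_component[OF assms] by simp
qed

lemma spanning_connected_subset:
  assumes "spanning_connected V A" "adj_closed A U" "u \<in> U" "u \<in> V"
  shows "V \<subseteq> U"
  using assms spanning_connected_iff[OF assms(4)] by simp

lemma spanning_connected_mono:
  assumes "spanning_connected V A" "A \<subseteq> B"
  shows "spanning_connected V B"
proof (cases "V = {}")
  case False
  then obtain u where "u \<in> V" by blast
  then show ?thesis
    using assms component_mono[of A B u] spanning_connected_iff_component[of u V]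
    by (meson order_trans)
qed (simp add: spanning_connected_def)

lemma spanning_connected_singleton [simp]: "spanning_connected {x} A"
  by (simp add: spanning_connected_def)

lemma adj_closed_Un [simp]: "adj_closed (A \<union> B) U \<longleftrightarrow> adj_closed A U \<and> adj_closed B U"
  unfolding adj_closed_def by blast

lemma adj_closed_insert [simp]:
  "adj_closed (insert {a, b} A) U \<longleftrightarrow> (a \<in> U \<longleftrightarrow> b \<in> U) \<and> adj_closed A U"
proof
  assume cl: "adj_closed (insert {a, b} A) U"
  have "{b, a} \<in> insert {a, b} A" by (simp add: insert_commute)
  then have "a \<in> U \<longleftrightarrow> b \<in> U" using adj_closedD[OF cl] insertI1 by metis
  moreover have "adj_closed A U" using cl unfolding adj_closed_def by simp
  ultimately show "(a \<in> U \<longleftrightarrow> b \<in> U) \<and> adj_closed A U" by simp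
next
  assume "(a \<in> U \<longleftrightarrow> b \<in> U) \<and> adj_closed A U"
  then show "adj_closed (insert {a, b} A) U"
    unfolding adj_closed_def insert_iff doubleton_eq_iff by metis
qed

section \<open>Gluing two graphs that share one vertex\<close>

lemma adj_closed_superset:
  assumes "\<Union>A \<subseteq> V"
  shows "adj_closed A V"
  unfolding adj_closed_def
proof (intro allI impI)
  fix x y assume "{x, y} \<in> A"
  then show "y \<in> V" using assms by blast
qed

text \<open>The pieces meet only in \<open>x\<close>, and \<open>x\<close> lies in
  \<open>U1\<close>; hence a vertex of \<open>V1\<close> in the patched set is always in
  \<open>U1\<close>, whichever part it came from, and edges of \<open>A\<close> cannot
  leave.\<close>

lemma adj_closed_glue:
  assumes x: "V1 \<inter> V2 = {x}" and A: "\<Union>A \<subseteq> V1"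
    and U: "adj_closed A U1" "x \<in> U1"
  shows "adj_closed A ((U1 \<inter> V1) \<union> (U2 \<inter> V2))"
  unfolding adj_closed_def
proof (intro allI impI)
  fix z y assume zy: "{z, y} \<in> A" and z: "z \<in> (U1 \<inter> V1) \<union> (U2 \<inter> V2)"
  have V: "z \<in> V1" "y \<in> V1" using zy A by auto
  have "z \<in> U1"
  proof (cases "z \<in> V2")
    case True
    then have "z = x" using V x by auto
    then show ?thesis using U by simp
  qed (use z in blast)
  then have "y \<in> U1" using adj_closedD[OF U(1) zy] by blast
  then show "y \<in> (U1 \<inter> V1) \<union> (U2 \<inter> V2)" using V by blast
qed

context
  fixes V1 V2 :: "nat set" and x :: nat and A1 A2 :: "nat set set"
  assumes x: "V1 \<inter> V2 = {x}" and A1: "\<Union>A1 \<subseteq> V1" and A2: "\<Union>A2 \<subseteq> V2"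
begin

private lemma x_mem: "x \<in> V1" "x \<in> V2" "x \<in> V1 \<union> V2"
  using x by auto

private lemma x_only: "z \<in> V1 \<Longrightarrow> z \<in> V2 \<Longrightarrow> z = x"
  using x by auto

private lemma glue_closed:
  assumes "adj_closed A1 U1" "adj_closed A2 U2" "x \<in> U1" "x \<in> U2"
  shows "adj_closed (A1 \<union> A2) ((U1 \<inter> V1) \<union> (U2 \<inter> V2))"
  using adj_closed_glue[OF x A1 assms(1,3), of U2]
    adj_closed_glue[OF x[unfolded Int_commute[of V1]] A2 assms(2,4), of U1]
  by (simp add: Un_commute)

private lemma glue_subset:
  assumes sub: "V1 \<union> V2 \<subseteq> (U1 \<inter> V1) \<union> (U2 \<inter> V2)" and U: "x \<in> U1" "x \<in> U2"
  shows "V1 \<subseteq> U1" "V2 \<subseteq> U2"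
proof safe
  fix z assume z: "z \<in> V1"
  then have "z \<in> (U1 \<inter> V1) \<union> (U2 \<inter> V2)" using sub by (meson UnI1 subsetD)
  then show "z \<in> U1" using x_only[OF z] U by auto
next
  fix z assume z: "z \<in> V2"
  then have "z \<in> (U1 \<inter> V1) \<union> (U2 \<inter> V2)" using sub by (meson UnI2 subsetD)
  then show "z \<in> U2" using x_only[of z] z U by auto
qed

private lemma glue_mem:
  assumes "x \<in> U1" "x \<in> U2"
  shows "a \<in> V1 \<Longrightarrow> a \<in> (U1 \<inter> V1) \<union> (U2 \<inter> V2) \<longleftrightarrow> a \<in> U1"
    "b \<in> V2 \<Longrightarrow> b \<in> (U1 \<inter> V1) \<union> (U2 \<inter> V2) \<longleftrightarrow> b \<in> U2"
  using assms x_only[of a] x_only[of b] by auto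

text \<open>A closed set of one piece, patched with the whole vertex set of the other, is closed in
  the glued graph; so a defect of either piece is a defect of the whole, and conversely.\<close>

lemma spanning_connected_glue:
  "spanning_connected (V1 \<union> V2) (A1 \<union> A2) \<longleftrightarrow>
   spanning_connected V1 A1 \<and> spanning_connected V2 A2" (is "?L \<longleftrightarrow> ?C1 \<and> ?C2")
proof
  assume L: ?L
  have key: "V1 \<subseteq> U1 \<and> V2 \<subseteq> U2"
    if "adj_closed A1 U1" "adj_closed A2 U2" "x \<in> U1" "x \<in> U2" for U1 U2
    using spanning_connected_subset[OF L glue_closed[OF that], of x] that x_mem
      glue_subset[of U1 U2] by blast
  have V: "adj_closed A1 V1" "adj_closed A2 V2"
    using A1 A2 adj_closed_superset by auto
  show "?C1 \<and> ?C2"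
    unfolding spanning_connected_iff[OF x_mem(1)] spanning_connected_iff[OF x_mem(2)]
    using key V x_mem by blast
next
  assume R: "?C1 \<and> ?C2"
  show ?L unfolding spanning_connected_iff[OF x_mem(3)]
  proof (intro allI impI, elim conjE)
    fix U assume U: "adj_closed (A1 \<union> A2) U" "x \<in> U"
    show "V1 \<union> V2 \<subseteq> U"
      using U R spanning_connected_subset[of V1 A1 U x] spanning_connected_subset[of V2 A2 U x]
        x_mem by simp
  qed
qed

text \<open>If one piece is connected, its end of the new edge can be slid to the cut vertex
  \<open>x\<close>, so that the edge serves the other piece. One edge cannot repair both pieces, so
  at least one must be connected by itself.\<close>

lemma spanning_connected_glue_insert:
  assumes a: "a \<in> V1" and b: "b \<in> V2"
  shows "spanning_connected (V1 \<union> V2) (insert {a, b} (A1 \<union> A2)) \<longleftrightarrow>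
         spanning_connected V1 A1 \<and> spanning_connected V2 (insert {x, b} A2) \<or>
         spanning_connected V1 (insert {a, x} A1) \<and> spanning_connected V2 A2"
    (is "?L \<longleftrightarrow> ?C1 \<and> ?T2 \<or> ?T1 \<and> ?C2")
proof
  assume L: ?L
  have key: "V1 \<subseteq> U1 \<and> V2 \<subseteq> U2"
    if U: "adj_closed A1 U1" "adj_closed A2 U2" "x \<in> U1" "x \<in> U2"
      and ab: "a \<in> U1 \<longleftrightarrow> b \<in> U2" for U1 U2
  proof -
    have "adj_closed (insert {a, b} (A1 \<union> A2)) ((U1 \<inter> V1) \<union> (U2 \<inter> V2))"
      unfolding adj_closed_insert glue_mem(1)[OF U(3,4) a] glue_mem(2)[OF U(3,4) b]
      using glue_closed[OF U] ab by blast
    moreover have "x \<in> (U1 \<inter> V1) \<union> (U2 \<inter> V2)" using U x_mem by blast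
    ultimately have "V1 \<union> V2 \<subseteq> (U1 \<inter> V1) \<union> (U2 \<inter> V2)"
      using spanning_connected_subset[OF L _ _ x_mem(3)] by blast
    from glue_subset[OF this U(3,4)] show ?thesis by simp
  qed
  have V: "adj_closed A1 V1" "adj_closed A2 V2"
    using A1 A2 adj_closed_superset by auto
  \<comment> \<open>Taking \<open>V2\<close> as the second set puts \<open>b\<close> inside, so the
    side condition of \<open>key\<close> becomes \<open>a \<in> U1\<close>, which closure under the
    edge from \<open>a\<close> to \<open>x\<close> supplies. \<open>T2\<close> is the mirror
    image.\<close>
  have T1: ?T1 unfolding spanning_connected_iff[OF x_mem(1)] adj_closed_insert
    using key[OF _ V(2) _ x_mem(2)] b by blast
  have T2: ?T2 unfolding spanning_connected_iff[OF x_mem(2)] adj_closed_insert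
    using key[OF V(1) _ x_mem(1)] a by blast
  have "?C1 \<or> ?C2"
  proof (rule ccontr)
    assume "\<not> (?C1 \<or> ?C2)"
    then obtain U1 U2 where U: "adj_closed A1 U1" "x \<in> U1" "\<not> V1 \<subseteq> U1"
        "adj_closed A2 U2" "x \<in> U2" "\<not> V2 \<subseteq> U2"
      unfolding spanning_connected_iff[OF x_mem(1)] spanning_connected_iff[OF x_mem(2)] by blast
    \<comment> \<open>The pair \<open>U1\<close>, \<open>V2\<close> forces
      \<open>a \<notin> U1\<close> and the pair \<open>V1\<close>, \<open>U2\<close> forces
      \<open>b \<notin> U2\<close>; then \<open>U1\<close>, \<open>U2\<close> agree on the new edge
      and \<open>key\<close> applies to them, a contradiction.\<close>
    show False
      using key[OF U(1,4,2,5)] key[OF U(1) V(2) U(2) x_mem(2)] key[OF V(1) U(4) x_mem(1) U(5)]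
        U(3,6) a b by metis
  qed
  with T1 T2 show "?C1 \<and> ?T2 \<or> ?T1 \<and> ?C2" by blast
next
  assume R: "?C1 \<and> ?T2 \<or> ?T1 \<and> ?C2"
  show ?L unfolding spanning_connected_iff[OF x_mem(3)]
  proof (intro allI impI, elim conjE)
    fix U assume "adj_closed (insert {a, b} (A1 \<union> A2)) U" and xU: "x \<in> U"
    then have cl: "adj_closed A1 U" "adj_closed A2 U" "a \<in> U \<longleftrightarrow> b \<in> U" by simp_all
    from R show "V1 \<union> V2 \<subseteq> U"
    proof (elim disjE conjE)
      assume C: ?C1 ?T2
      have V1U: "V1 \<subseteq> U" using spanning_connected_subset[OF C(1) cl(1) xU x_mem(1)] .
      then have "adj_closed (insert {x, b} A2) U" using a cl xU by auto
      from spanning_connected_subset[OF C(2) this xU x_mem(2)] V1U show ?thesis by blast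
    next
      assume C: ?T1 ?C2
      have V2U: "V2 \<subseteq> U" using spanning_connected_subset[OF C(2) cl(2) xU x_mem(2)] .
      then have "adj_closed (insert {a, x} A1) U" using b cl xU by auto
      from spanning_connected_subset[OF C(1) this xU x_mem(1)] V2U show ?thesis by blast
    qed
  qed
qed

end


section \<open>Decomposition by the component of a vertex\<close>

definition induced :: "nat set set \<Rightarrow> nat set \<Rightarrow> nat set set" where
  "induced E W = {e \<in> E. e \<subseteq> W}"

text \<open>A walk inside \<open>U\<close> that starts in \<open>W\<close> never leaves
  \<open>W\<close>, so \<open>W\<close> stays connected using only its own edges. The set
  \<open>U\<close> will be all vertices, or all but one deleted vertex.\<close>

lemma component_induced:
  assumes pairs: "\<forall>e\<in>A. card e = 2" and u: "u \<in> U"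
  defines "W \<equiv> component (induced A U) u"
  shows "W \<subseteq> U" "u \<in> W" "spanning_connected W (induced A W)"
    "\<And>e. e \<in> A \<Longrightarrow> e \<subseteq> U \<Longrightarrow> e \<inter> W \<noteq> {} \<Longrightarrow> e \<subseteq> W"
proof -
  have cl: "adj_closed (induced A U) W" unfolding W_def by (rule adj_closed_component)
  show WU: "W \<subseteq> U" unfolding W_def
    by (rule component_least) (use u in \<open>auto simp: adj_closed_def induced_def\<close>)
  show uW: "u \<in> W" by (simp add: W_def)
  have "W \<subseteq> component (induced A W) u \<inter> W"
  proof (subst W_def, rule component_least)
    show "adj_closed (induced A U) (component (induced A W) u \<inter> W)"
      unfolding adj_closed_def
    proof safe
      fix x y assume xy: "{x, y} \<in> induced A U" "x \<in> component (induced A W) u" "x \<in> W"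
      then show "y \<in> W" using cl adj_closedD by blast
      with xy have "{x, y} \<in> induced A W" by (auto simp: induced_def)
      with xy show "y \<in> component (induced A W) u"
        using adj_closed_component adj_closedD by blast
    qed
  qed (simp add: uW)
  then show "spanning_connected W (induced A W)"
    using spanning_connected_iff_component[OF uW] by blast
  show "e \<subseteq> W" if e: "e \<in> A" "e \<subseteq> U" "e \<inter> W \<noteq> {}" for e
  proof -
    have "card e = 2" using e pairs by blast
    then obtain x' y' where "e = {x', y'}" by (auto simp: card_2_iff)
    then obtain x y where "e = {x, y}" "x \<in> W" using e by (auto simp: insert_commute)
    with e cl show ?thesis using adj_closedD[of "induced A U" W x y]
      by (auto simp: induced_def)
  qed
qed

text \<open>Sort the edge sets by the component \<open>W\<close> of \<open>u\<close> inside
  \<open>U\<close>. An edge within \<open>U\<close> that touches \<open>W\<close> is either in the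
  connected part \<open>A1\<close> or absent; all other edges are free and form \<open>A2\<close>.
  Every expansion below is an instance of this bijection.\<close>

lemma component_decomposition:
  fixes f :: "nat set set \<Rightarrow> real"
  assumes fin: "finite E" "finite U" and u: "u \<in> U" and pairs: "\<forall>e\<in>E. card e = 2"
  shows "(\<Sum>A\<in>Pow E. f A) =
    (\<Sum>W | W \<subseteq> U \<and> u \<in> W. \<Sum>A1 | A1 \<subseteq> induced E W \<and> spanning_connected W A1.
       \<Sum>A2\<in>Pow {e \<in> E. \<not> (e \<subseteq> U \<and> e \<inter> W \<noteq> {})}. f (A1 \<union> A2))"
proof -
  let ?S = "\<lambda>W. {A1. A1 \<subseteq> induced E W \<and> spanning_connected W A1}"
  let ?R = "\<lambda>W. Pow {e \<in> E. \<not> (e \<subseteq> U \<and> e \<inter> W \<noteq> {})}"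
  let ?D = "SIGMA W:{W. W \<subseteq> U \<and> u \<in> W}. ?S W \<times> ?R W"
  let ?W = "\<lambda>A. component (induced A U) u"
  let ?i = "\<lambda>A. (?W A, induced A (?W A), A - induced A (?W A))"
  have finS: "finite (?S W)" for W
    by (rule finite_subset[of _ "Pow E"]) (use fin in \<open>auto simp: induced_def\<close>)
  have fwd: "?i A \<in> ?D" if A: "A \<subseteq> E" for A
  proof -
    define W where "W = ?W A"
    have pairsA: "\<forall>e\<in>A. card e = 2" using pairs A by blast
    note W = component_induced[OF pairsA u, folded W_def]
    have "A - induced A W \<in> ?R W" using A W(4) by (auto simp: induced_def)
    moreover have "induced A W \<subseteq> induced E W" using A by (auto simp: induced_def)
    ultimately show ?thesis unfolding W_def[symmetric] using W(1-3) by auto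
  qed
  have bwd: "A1 \<union> A2 \<subseteq> E \<and> ?i (A1 \<union> A2) = (W, A1, A2)"
    if D: "(W, A1, A2) \<in> ?D" for W A1 A2
  proof -
    have W: "W \<subseteq> U" "u \<in> W" and A1: "A1 \<subseteq> induced E W" and sc: "spanning_connected W A1"
      and A2: "A2 \<in> ?R W" using D by auto
    have sub: "A1 \<union> A2 \<subseteq> E" using A1 A2 by (auto simp: induced_def)
    have "adj_closed (induced (A1 \<union> A2) U) W"
      using A1 A2 by (fastforce simp: adj_closed_def induced_def)
    then have 1: "?W (A1 \<union> A2) \<subseteq> W" using W by (intro component_least)
    have "A1 \<subseteq> induced (A1 \<union> A2) U" using A1 W by (auto simp: induced_def)
    then have 2: "W \<subseteq> ?W (A1 \<union> A2)"
      using sc component_mono spanning_connected_iff_component[OF W(2)] by (meson order_trans)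
    have WW: "?W (A1 \<union> A2) = W" using 1 2 by blast
    \<comment> \<open>An empty edge would lie inside \<open>W\<close> without meeting it and so
      could belong to both parts; the cardinality condition on edges excludes this.\<close>
    have ne: "e \<noteq> {}" if "e \<in> E" for e using pairs that by auto
    have notin: "\<not> e \<subseteq> W" if "e \<in> A2" for e
    proof
      assume "e \<subseteq> W"
      moreover have "e \<noteq> {}" using that A2 ne by auto
      ultimately have "e \<inter> W \<noteq> {}" "e \<subseteq> U" using W by blast+
      with that A2 show False by auto
    qed
    have ind: "induced (A1 \<union> A2) W = A1"
    proof (rule set_eqI)
      fix e show "e \<in> induced (A1 \<union> A2) W \<longleftrightarrow> e \<in> A1"
        using subsetD[OF A1, of e] notin[of e] by (simp add: induced_def) metis
    qed
    have "A1 \<inter> A2 = {}"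
    proof (rule equals0I)
      fix e assume "e \<in> A1 \<inter> A2"
      then show False using subsetD[OF A1, of e] notin[of e] by (simp add: induced_def)
    qed
    then have "(A1 \<union> A2) - A1 = A2" by blast
    then show ?thesis using sub unfolding WW ind by (simp only: simp_thms)
  qed
  have "(\<Sum>A\<in>Pow E. f A) = (\<Sum>(W, A1, A2)\<in>?D. f (A1 \<union> A2))"
  proof (rule sum.reindex_bij_witness[of _ "\<lambda>(W, A1, A2). A1 \<union> A2" ?i])
    fix A assume "A \<in> Pow E"
    then have "A \<subseteq> E" by simp
    from fwd[OF this] show "?i A \<in> ?D" .
    have eq: "induced A (?W A) \<union> (A - induced A (?W A)) = A" by (auto simp: induced_def)
    then show "(case ?i A of (W, A1, A2) \<Rightarrow> A1 \<union> A2) = A"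
      "(case ?i A of (W, A1, A2) \<Rightarrow> f (A1 \<union> A2)) = f A" by simp_all
  next
    fix D assume "D \<in> ?D"
    then obtain W A1 A2 where D: "D = (W, A1, A2)" "(W, A1, A2) \<in> ?D"
      by (cases D) blast
    note b = bwd[OF D(2)]
    show "?i (case D of (W, A1, A2) \<Rightarrow> A1 \<union> A2) = D"
      unfolding D(1) prod.case by (rule b[THEN conjunct2])
    show "(case D of (W, A1, A2) \<Rightarrow> A1 \<union> A2) \<in> Pow E"
      unfolding D(1) prod.case by (rule PowI) (rule b[THEN conjunct1])
  qed
  also have "\<dots> = (\<Sum>W | W \<subseteq> U \<and> u \<in> W. \<Sum>(A1, A2)\<in>?S W \<times> ?R W. f (A1 \<union> A2))"
  proof (rule sum.Sigma[symmetric])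
    show "finite {W. W \<subseteq> U \<and> u \<in> W}" using fin(2) by simp
    have "finite (?R W)" for W using fin(1) by simp
    with finS show "\<forall>W\<in>{W. W \<subseteq> U \<and> u \<in> W}. finite (?S W \<times> ?R W)"
      by (intro ballI finite_cartesian_product)
  qed
  also have "\<dots> = (\<Sum>W | W \<subseteq> U \<and> u \<in> W. \<Sum>A1\<in>?S W. \<Sum>A2\<in>?R W. f (A1 \<union> A2))"
    by (simp only: sum.cartesian_product)
  finally show ?thesis .
qed


section \<open>Connected and split generating sums\<close>

text \<open>For a connected graph this is, with \<open>v = y - 1\<close>, the Tutte polynomial at
  \<open>(1, y)\<close> times a power of \<open>v\<close>.\<close>

definition conn_poly :: "nat set \<Rightarrow> nat set set \<Rightarrow> real \<Rightarrow> real" where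
  "conn_poly V E v = (\<Sum>A | A \<subseteq> E \<and> spanning_connected V A. v ^ card A)"

text \<open>For vertices \<open>a\<close> and \<open>b\<close> of \<open>V\<close>, these
  \<open>A\<close> have exactly two components, one around each terminal. Testing with the extra
  edge avoids naming the components and matches the insertion of that edge into the graph.\<close>

definition split_poly :: "nat set \<Rightarrow> nat set set \<Rightarrow> nat \<Rightarrow> nat \<Rightarrow> real \<Rightarrow> real" where
  "split_poly V E a b v =
     (\<Sum>A | A \<subseteq> E \<and> \<not> spanning_connected V A \<and> spanning_connected V (insert {a, b} A). v ^ card A)"

lemma Rel_eq_conn_poly:
  assumes "finite E" "q \<noteq> 0"
  shows "Rel V E q = q ^ card E * conn_poly V E ((1 - q) / q)"
proof -
  have "(1 - q) ^ card A * q ^ (card E - card A) = q ^ card E * ((1 - q) / q) ^ card A"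
    if "A \<subseteq> E" for A
    using card_mono[OF assms(1) that] assms(2)
    by (simp add: power_divide power_diff)
  then show ?thesis
    unfolding Rel_def conn_poly_def sum_distrib_left by (intro sum.cong) auto
qed

lemma finite_simple_graph: "simple_graph V E \<Longrightarrow> finite E"
  unfolding simple_graph_def by (metis Pow_iff finite_Pow_iff finite_subset subsetI)

lemma sum_Pow_power:
  fixes v :: real
  assumes "finite E"
  shows "(\<Sum>A\<in>Pow E. v ^ card A) = (1 + v) ^ card E"
  using assms
proof (induction E)
  case (insert x E)
  have "(\<Sum>A\<in>Pow (insert x E). v ^ card A)
      = (\<Sum>A\<in>Pow E. v ^ card A) + (\<Sum>A\<in>insert x ` Pow E. v ^ card A)"
    unfolding Pow_insert by (rule sum.union_disjoint) (use insert in auto)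
  also have "(\<Sum>A\<in>insert x ` Pow E. v ^ card A) = (\<Sum>A\<in>Pow E. v ^ card (insert x A))"
    by (rule sum.reindex_cong[of "insert x"]) (use insert in \<open>auto simp: inj_on_def\<close>)
  also have "\<dots> = (\<Sum>A\<in>Pow E. v * v ^ card A)"
  proof (rule sum.cong)
    fix A assume "A \<in> Pow E"
    then have "finite A" "x \<notin> A" using insert finite_subset by auto
    then show "v ^ card (insert x A) = v * v ^ card A" by simp
  qed simp
  finally show ?case using insert by (simp add: sum_distrib_left[symmetric] algebra_simps)
qed simp

lemma sum_Pow_card:
  fixes g :: "nat \<Rightarrow> real"
  assumes "finite X"
  shows "(\<Sum>A\<in>Pow X. g (card A)) = (\<Sum>j\<le>card X. (card X choose j) * g j)"
proof -
  have "(\<Sum>A\<in>Pow X. g (card A)) = (\<Sum>j\<le>card X. \<Sum>A | A \<in> Pow X \<and> card A = j. g (card A))"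
    by (rule sum.group[symmetric]) (use assms card_mono in auto)
  also have "\<dots> = (\<Sum>j\<le>card X. (card X choose j) * g j)"
    using n_subsets[OF assms] by (intro sum.cong) auto
  finally show ?thesis .
qed

text \<open>A connected set that uses the new edge leaves, on its removal, either a connected set or
  one split between \<open>a\<close> and \<open>b\<close>. Connected sets of \<open>E\<close> thus
  occur with and without the edge, split ones only with it.\<close>

lemma conn_poly_insert:
  assumes "finite E" "{a, b} \<notin> E"
  shows "conn_poly V (insert {a, b} E) v = (1 + v) * conn_poly V E v + v * split_poly V E a b v"
proof -
  let ?e = "{a, b}"
  let ?C = "{A. A \<subseteq> E \<and> spanning_connected V A}"
  let ?S = "{A. A \<subseteq> E \<and> \<not> spanning_connected V A \<and> spanning_connected V (insert ?e A)}"
  have fin: "finite ?C" "finite ?S"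
    by (rule finite_subset[of _ "Pow E"], use assms in auto)+
  have eq: "{A. A \<subseteq> insert ?e E \<and> spanning_connected V A} = ?C \<union> insert ?e ` (?C \<union> ?S)"
  proof (rule set_eqI, rule iffI)
    fix A assume A: "A \<in> {A. A \<subseteq> insert ?e E \<and> spanning_connected V A}"
    show "A \<in> ?C \<union> insert ?e ` (?C \<union> ?S)"
    proof (cases "?e \<in> A")
      case True
      then have "A = insert ?e (A - {?e})" by blast
      moreover have "A - {?e} \<in> ?C \<union> ?S" using A True by (auto simp: insert_absorb)
      ultimately show ?thesis by blast
    next
      case False
      then show ?thesis using A by auto
    qed
  next
    fix A assume "A \<in> ?C \<union> insert ?e ` (?C \<union> ?S)"
    then show "A \<in> {A. A \<subseteq> insert ?e E \<and> spanning_connected V A}"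
      using spanning_connected_mono[OF _ subset_insertI] by auto
  qed
  have inj: "inj_on (insert ?e) (?C \<union> ?S)"
  proof (rule inj_onI)
    fix A B assume "A \<in> ?C \<union> ?S" "B \<in> ?C \<union> ?S" and eq: "insert ?e A = insert ?e B"
    then have "?e \<notin> A" "?e \<notin> B" using assms(2) by auto
    with eq show "A = B" by (metis insert_ident)
  qed
  have card: "card (insert ?e A) = Suc (card A)" if "A \<subseteq> E" for A
    using that assms finite_subset by (subst card_insert_disjoint) auto
  have "conn_poly V (insert ?e E) v
      = (\<Sum>A\<in>?C. v ^ card A) + (\<Sum>A\<in>insert ?e ` (?C \<union> ?S). v ^ card A)"
    unfolding conn_poly_def eq by (rule sum.union_disjoint) (use fin assms in auto)
  also have "(\<Sum>A\<in>insert ?e ` (?C \<union> ?S). v ^ card A) = (\<Sum>A\<in>?C \<union> ?S. v * v ^ card A)"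
    by (rule sum.reindex_cong[OF inj refl]) (use card in auto)
  also have "\<dots> = v * (\<Sum>A\<in>?C. v ^ card A) + v * (\<Sum>A\<in>?S. v ^ card A)"
    by (subst sum.union_disjoint) (use fin in \<open>auto simp: sum_distrib_left\<close>)
  finally show ?thesis by (simp add: conn_poly_def split_poly_def algebra_simps)
qed

section \<open>Product rules at a cut vertex\<close>

lemma sum_Pow_disjoint_Un:
  fixes f :: "'a set \<Rightarrow> real"
  assumes "finite E1" "finite E2" "E1 \<inter> E2 = {}"
  shows "(\<Sum>A\<in>Pow (E1 \<union> E2). f A) = (\<Sum>A1\<in>Pow E1. \<Sum>A2\<in>Pow E2. f (A1 \<union> A2))"
proof -
  have "(\<Sum>A\<in>Pow (E1 \<union> E2). f A) = (\<Sum>(A1, A2)\<in>Pow E1 \<times> Pow E2. f (A1 \<union> A2))"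
    by (rule sum.reindex_bij_witness[of _ "\<lambda>(A1, A2). A1 \<union> A2" "\<lambda>A. (A \<inter> E1, A \<inter> E2)"])
      (use assms in \<open>auto intro: arg_cong[where f = f]\<close>)
  then show ?thesis by (simp add: sum.cartesian_product)
qed

lemma sum_of_bool_filter:
  fixes f :: "'a \<Rightarrow> real"
  assumes "finite S"
  shows "(\<Sum>A | A \<in> S \<and> P A. f A) = (\<Sum>A\<in>S. of_bool (P A) * f A)"
  using assms by (intro sum.mono_neutral_cong_left) auto

lemma conn_poly_of_bool:
  "finite E \<Longrightarrow> conn_poly V E v = (\<Sum>A\<in>Pow E. of_bool (spanning_connected V A) * v ^ card A)"
  unfolding conn_poly_def using sum_of_bool_filter[of "Pow E"] by simp

lemma split_poly_of_bool:
  "finite E \<Longrightarrow> split_poly V E a b v = (\<Sum>A\<in>Pow E. of_bool (\<not> spanning_connected V A \<and>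
     spanning_connected V (insert {a, b} A)) * v ^ card A)"
  unfolding split_poly_def using sum_of_bool_filter[of "Pow E"] by simp

lemma card_Un_Pow:
  assumes "finite E1" "finite E2" "E1 \<inter> E2 = {}" "A1 \<in> Pow E1" "A2 \<in> Pow E2"
  shows "card (A1 \<union> A2) = card A1 + card A2"
  by (rule card_Un_disjoint) (use assms finite_subset in auto)

context
  fixes V1 V2 :: "nat set" and x :: nat and E1 E2 :: "nat set set"
  assumes x: "V1 \<inter> V2 = {x}" and E: "\<Union>E1 \<subseteq> V1" "\<Union>E2 \<subseteq> V2"
    and fin: "finite E1" "finite E2" and disj: "E1 \<inter> E2 = {}"
begin

lemma conn_poly_glue:
  "conn_poly (V1 \<union> V2) (E1 \<union> E2) v = conn_poly V1 E1 v * conn_poly V2 E2 v"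
proof -
  have eq: "of_bool (spanning_connected (V1 \<union> V2) (A1 \<union> A2)) * v ^ card (A1 \<union> A2) =
      (of_bool (spanning_connected V1 A1) * v ^ card A1) *
      (of_bool (spanning_connected V2 A2) * v ^ card A2)"
    if A: "A1 \<in> Pow E1" "A2 \<in> Pow E2" for A1 A2
  proof -
    have "\<Union>A1 \<subseteq> V1" "\<Union>A2 \<subseteq> V2" using A E by (meson PowD Union_mono order_trans)+
    from spanning_connected_glue[OF x this] card_Un_Pow[OF fin disj A] show ?thesis
      by (simp add: power_add)
  qed
  have finU: "finite (E1 \<union> E2)" using fin by simp
  show ?thesis
    unfolding conn_poly_of_bool[OF finU] conn_poly_of_bool[OF fin(1)] conn_poly_of_bool[OF fin(2)]
      sum_Pow_disjoint_Un[OF fin disj] sum_product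
    by (intro sum.cong refl eq)
qed

text \<open>Exactly one of the two pieces is split; the other is connected and carries its terminal
  to the cut vertex \<open>x\<close>.\<close>

lemma split_poly_glue:
  assumes a: "a \<in> V1" and b: "b \<in> V2"
  shows "split_poly (V1 \<union> V2) (E1 \<union> E2) a b v =
    conn_poly V1 E1 v * split_poly V2 E2 x b v + split_poly V1 E1 a x v * conn_poly V2 E2 v"
proof -
  have eq: "of_bool (\<not> spanning_connected (V1 \<union> V2) (A1 \<union> A2) \<and>
        spanning_connected (V1 \<union> V2) (insert {a, b} (A1 \<union> A2))) * v ^ card (A1 \<union> A2) =
      (of_bool (spanning_connected V1 A1) * v ^ card A1) *
      (of_bool (\<not> spanning_connected V2 A2 \<and> spanning_connected V2 (insert {x, b} A2)) * v ^ card A2)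
      + (of_bool (\<not> spanning_connected V1 A1 \<and> spanning_connected V1 (insert {a, x} A1)) * v ^ card A1) *
      (of_bool (spanning_connected V2 A2) * v ^ card A2)"
    if A: "A1 \<in> Pow E1" "A2 \<in> Pow E2" for A1 A2
  proof -
    have "\<Union>A1 \<subseteq> V1" "\<Union>A2 \<subseteq> V2" using A E by (meson PowD Union_mono order_trans)+
    from spanning_connected_glue[OF x this] spanning_connected_glue_insert[OF x this a b]
      card_Un_Pow[OF fin disj A] show ?thesis
      by (auto simp: power_add)
  qed
  have finU: "finite (E1 \<union> E2)" using fin by simp
  show ?thesis
    unfolding split_poly_of_bool[OF finU] split_poly_of_bool[OF fin(1)] split_poly_of_bool[OF fin(2)]
      conn_poly_of_bool[OF fin(1)] conn_poly_of_bool[OF fin(2)]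
      sum_Pow_disjoint_Un[OF fin disj] sum_product sum.distrib[symmetric]
    by (intro sum.cong refl eq)
qed

end


section \<open>Recursions for the generating sums\<close>

lemma simple_graph_induced: "simple_graph V E \<Longrightarrow> W \<subseteq> V \<Longrightarrow> simple_graph W (induced E W)"
  unfolding simple_graph_def induced_def by (auto intro: finite_subset)

lemma simple_graph_edge_subset: "simple_graph V E \<Longrightarrow> e \<in> E \<Longrightarrow> e \<subseteq> V"
  unfolding simple_graph_def by blast

lemma simple_graph_edge_card: "simple_graph V E \<Longrightarrow> e \<in> E \<Longrightarrow> card e = 2"
  unfolding simple_graph_def by blast

lemma simple_graph_finite_vertices: "simple_graph V E \<Longrightarrow> finite V"
  unfolding simple_graph_def by blast

lemma finite_induced: "finite E \<Longrightarrow> finite (induced E W)"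
  unfolding induced_def by simp

lemma induced_disjoint:
  assumes "simple_graph V E"
  shows "induced E W \<inter> induced E (V - W) = {}"
proof (rule equals0I)
  fix e assume "e \<in> induced E W \<inter> induced E (V - W)"
  then have "e \<in> E" "e \<subseteq> W \<inter> (V - W)" unfolding induced_def by auto
  moreover from this have "e = {}" by blast
  ultimately show False using simple_graph_edge_card[OF assms, of e] by simp
qed

text \<open>Once \<open>W\<close> is fixed, the connected part \<open>A1\<close> influences the
  summand only through its size, so the double sum is a product.\<close>

lemma component_sum_factor:
  fixes h :: "nat set set \<Rightarrow> real"
  assumes "finite E" "finite R" "induced E W \<inter> R = {}"
    and f: "\<And>A1 A2. A1 \<subseteq> induced E W \<Longrightarrow> spanning_connected W A1 \<Longrightarrow> A2 \<subseteq> R \<Longrightarrow>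
      g (A1 \<union> A2) = h A2"
  shows "(\<Sum>A1 | A1 \<subseteq> induced E W \<and> spanning_connected W A1.
       \<Sum>A2\<in>Pow R. g (A1 \<union> A2) * v ^ card (A1 \<union> A2)) =
     conn_poly W (induced E W) v * (\<Sum>A2\<in>Pow R. h A2 * v ^ card A2)"
  unfolding conn_poly_def sum_product
proof (intro sum.cong refl)
  fix A1 A2 assume A: "A1 \<in> {A1. A1 \<subseteq> induced E W \<and> spanning_connected W A1}" "A2 \<in> Pow R"
  then have "card (A1 \<union> A2) = card A1 + card A2"
    by (intro card_Un_Pow[OF finite_induced[OF assms(1)] assms(2,3)]) auto
  with f[of A1 A2] A show "g (A1 \<union> A2) * v ^ card (A1 \<union> A2) = v ^ card A1 * (h A2 * v ^ card A2)"
    by (simp add: power_add)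
qed

lemma component_complement:
  assumes "simple_graph V E" "W \<subseteq> V"
  shows "{e \<in> E. \<not> (e \<subseteq> V \<and> e \<inter> W \<noteq> {})} = induced E (V - W)"
  using simple_graph_edge_subset[OF assms(1)] unfolding induced_def by blast

text \<open>The left side weighs all edge subsets. Sorted by the component \<open>W\<close> of
  \<open>u\<close>, each leaves an arbitrary subset outside \<open>W\<close>; edges between
  \<open>W\<close> and its complement are absent.\<close>

lemma power_card_edges_recursion:
  fixes v :: real
  assumes G: "simple_graph V E" and u: "u \<in> V"
  shows "(1 + v) ^ card E = (\<Sum>W | W \<subseteq> V \<and> u \<in> W.
    conn_poly W (induced E W) v * (1 + v) ^ card (induced E (V - W)))"
proof -
  note fin = finite_simple_graph[OF G]
  have pairs: "\<forall>e\<in>E. card e = 2" using simple_graph_edge_card[OF G] by blast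
  have "(1 + v) ^ card E = (\<Sum>A\<in>Pow E. 1 * v ^ card A)"
    using sum_Pow_power[OF fin] by simp
  also have "\<dots> = (\<Sum>W | W \<subseteq> V \<and> u \<in> W. \<Sum>A1 | A1 \<subseteq> induced E W \<and> spanning_connected W A1.
       \<Sum>A2\<in>Pow (induced E (V - W)). 1 * v ^ card (A1 \<union> A2))"
    unfolding component_decomposition[OF fin simple_graph_finite_vertices[OF G] u pairs]
    by (intro sum.cong refl) (use component_complement[OF G] in auto)
  also have "\<dots> = (\<Sum>W | W \<subseteq> V \<and> u \<in> W.
    conn_poly W (induced E W) v * (\<Sum>A\<in>Pow (induced E (V - W)). 1 * v ^ card A))"
    by (intro sum.cong refl
        component_sum_factor[OF fin finite_induced[OF fin] induced_disjoint[OF G],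
          where g = "\<lambda>_. 1" and h = "\<lambda>_. 1"])
  finally show ?thesis using sum_Pow_power[OF finite_induced[OF fin]] by simp
qed

section \<open>Connectivity conditions in terms of one component\<close>

lemma adj_closed_Un_disjoint:
  assumes "\<Union>A1 \<subseteq> W" "\<Union>A2 \<inter> W = {}"
  shows "adj_closed (A1 \<union> A2) W"
proof -
  have "adj_closed A2 W" unfolding adj_closed_def
  proof (intro allI impI)
    fix x y assume "{x, y} \<in> A2" "x \<in> W"
    then have "x \<in> \<Union>A2 \<inter> W" by blast
    then show "y \<in> W" using assms(2) by blast
  qed
  then show ?thesis using adj_closed_superset[OF assms(1)] by simp
qed

lemma adj_closed_Un_Int:
  assumes "\<Union>A1 \<subseteq> W" "\<Union>A2 \<subseteq> V - W" "adj_closed A2 U"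
  shows "adj_closed (A1 \<union> A2) (W \<union> (U \<inter> (V - W)))"
  unfolding adj_closed_def
proof (intro allI impI)
  fix x y assume xy: "{x, y} \<in> A1 \<union> A2" and x: "x \<in> W \<union> (U \<inter> (V - W))"
  show "y \<in> W \<union> (U \<inter> (V - W))"
  proof (cases "{x, y} \<in> A1")
    case True
    then show ?thesis using assms(1) by blast
  next
    case False
    with xy have e: "{x, y} \<in> A2" by simp
    then have V: "x \<in> V - W" "y \<in> V - W" using assms(2) by blast+
    then have "x \<in> U" using x by simp
    from adj_closedD[OF assms(3) e this] V show ?thesis by simp
  qed
qed

text \<open>No edge of \<open>A1 \<union> A2\<close> leaves \<open>W\<close>, so only the test edge
  from \<open>u\<close> to \<open>b\<close> can reach the rest. It does so only if \<open>b\<close>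
  lies outside \<open>W\<close>, and then the rest must be connected on its own.\<close>

lemma split_component_iff:
  assumes W: "W \<subseteq> V" "u \<in> W" and b: "b \<in> V" and A1: "\<Union>A1 \<subseteq> W" "spanning_connected W A1"
    and A2: "\<Union>A2 \<subseteq> V - W"
  shows "\<not> spanning_connected V (A1 \<union> A2) \<and> spanning_connected V (insert {u, b} (A1 \<union> A2)) \<longleftrightarrow>
    b \<notin> W \<and> spanning_connected (V - W) A2" (is "?L \<longleftrightarrow> ?R")
proof -
  have uV: "u \<in> V" using W by blast
  have cl: "adj_closed (A1 \<union> A2) W"
    using adj_closed_Un_disjoint[OF A1(1), of A2] A2 by blast
  show ?thesis
  proof (cases "b \<in> W")
    case True
    then have clb: "adj_closed (insert {u, b} (A1 \<union> A2)) W" using cl W by simp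
    have "\<not> ?L"
    proof
      assume L: ?L
      then have "V \<subseteq> W" using spanning_connected_subset[OF _ clb W(2) uV] by simp
      then have "spanning_connected V A1" using A1(2) W(1) by (metis subset_antisym)
      then show False using L spanning_connected_mono[of V A1 "A1 \<union> A2"] by simp
    qed
    with True show ?thesis by simp
  next
    case False
    then have bV: "b \<in> V - W" using b by simp
    have n: "\<not> spanning_connected V (A1 \<union> A2)"
      using spanning_connected_subset[OF _ cl W(2) uV] False b by blast
    have "spanning_connected V (insert {u, b} (A1 \<union> A2)) \<longleftrightarrow> spanning_connected (V - W) A2"
    proof
      assume L: "spanning_connected V (insert {u, b} (A1 \<union> A2))"
      show "spanning_connected (V - W) A2" unfolding spanning_connected_iff[OF bV]
      proof (intro allI impI, elim conjE)
        fix U assume U: "adj_closed A2 U" "b \<in> U"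
        have "adj_closed (insert {u, b} (A1 \<union> A2)) (W \<union> (U \<inter> (V - W)))"
          unfolding adj_closed_insert
          using adj_closed_Un_Int[OF A1(1) A2 U(1)] U(2) bV W(2) by simp
        from spanning_connected_subset[OF L this _ uV] W(2)
        have "V \<subseteq> W \<union> (U \<inter> (V - W))" by simp
        then show "V - W \<subseteq> U" by auto
      qed
    next
      assume R: "spanning_connected (V - W) A2"
      show "spanning_connected V (insert {u, b} (A1 \<union> A2))"
        unfolding spanning_connected_iff[OF uV]
      proof (intro allI impI, elim conjE)
        fix U assume U: "adj_closed (insert {u, b} (A1 \<union> A2)) U" "u \<in> U"
        then have "b \<in> U" "adj_closed A1 U" "adj_closed A2 U" by simp_all
        then have "W \<subseteq> U" "V - W \<subseteq> U"
          using spanning_connected_subset[OF A1(2) _ U(2) W(2)] spanning_connected_subset[OF R _ _ bV]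
          by simp_all
        then show "V \<subseteq> U" by auto
      qed
    qed
    then show ?thesis using n False by simp
  qed
qed

lemma split_poly_recursion:
  assumes G: "simple_graph V E" and u: "u \<in> V" and b: "b \<in> V"
  shows "split_poly V E u b v = (\<Sum>W | W \<subseteq> V \<and> u \<in> W \<and> b \<notin> W.
    conn_poly W (induced E W) v * conn_poly (V - W) (induced E (V - W)) v)"
proof -
  note fin = finite_simple_graph[OF G]
  have pairs: "\<forall>e\<in>E. card e = 2" using simple_graph_edge_card[OF G] by blast
  let ?g = "\<lambda>A. of_bool (\<not> spanning_connected V A \<and> spanning_connected V (insert {u, b} A)) :: real"
  let ?h = "\<lambda>W A. of_bool (b \<notin> W \<and> spanning_connected (V - W) A) :: real"
  have "split_poly V E u b v = (\<Sum>A\<in>Pow E. ?g A * v ^ card A)"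
    by (rule split_poly_of_bool[OF fin])
  also have "\<dots> = (\<Sum>W | W \<subseteq> V \<and> u \<in> W. \<Sum>A1 | A1 \<subseteq> induced E W \<and> spanning_connected W A1.
       \<Sum>A2\<in>Pow (induced E (V - W)). ?g (A1 \<union> A2) * v ^ card (A1 \<union> A2))"
    unfolding component_decomposition[OF fin simple_graph_finite_vertices[OF G] u pairs]
    by (intro sum.cong refl) (use component_complement[OF G] in auto)
  also have "\<dots> = (\<Sum>W | W \<subseteq> V \<and> u \<in> W.
    conn_poly W (induced E W) v * (\<Sum>A\<in>Pow (induced E (V - W)). ?h W A * v ^ card A))"
  proof (intro sum.cong refl component_sum_factor[OF fin finite_induced[OF fin] induced_disjoint[OF G]])
    fix W A1 A2 assume "W \<in> {W. W \<subseteq> V \<and> u \<in> W}" "A1 \<subseteq> induced E W" "spanning_connected W A1"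
      "A2 \<subseteq> induced E (V - W)"
    moreover from this have "\<Union>A1 \<subseteq> W" "\<Union>A2 \<subseteq> V - W" unfolding induced_def by auto
    ultimately show "?g (A1 \<union> A2) = ?h W A2"
      using split_component_iff[of W V u b A1 A2] b by simp
  qed
  also have "\<dots> = (\<Sum>W | W \<subseteq> V \<and> u \<in> W. of_bool (b \<notin> W) *
    (conn_poly W (induced E W) v * conn_poly (V - W) (induced E (V - W)) v))"
    unfolding conn_poly_of_bool[OF finite_induced[OF fin]]
    by (intro sum.cong refl) simp
  also have "\<dots> = (\<Sum>W | W \<subseteq> V \<and> u \<in> W \<and> b \<notin> W.
    conn_poly W (induced E W) v * conn_poly (V - W) (induced E (V - W)) v)"
    by (intro sum.mono_neutral_cong_right)
      (use simple_graph_finite_vertices[OF G] in auto)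
  finally show ?thesis .
qed

text \<open>With \<open>r\<close> deleted, \<open>W\<close> is cut off, so it is attached only
  through the edges \<open>B\<close> at \<open>r\<close>: at least one is needed and any one
  suffices. These edges lead only into \<open>W\<close>, hence cannot help to connect the
  rest.\<close>

lemma connected_component_iff:
  assumes W: "W \<subseteq> V - {r}" "W \<noteq> {}" and r: "r \<in> V"
    and A1: "\<Union>A1 \<subseteq> W" "spanning_connected W A1"
    and A2: "\<Union>A2 \<subseteq> V - W" and B: "\<forall>e\<in>B. \<exists>w\<in>W. e = {r, w}"
  shows "spanning_connected V (A1 \<union> (A2 \<union> B)) \<longleftrightarrow> B \<noteq> {} \<and> spanning_connected (V - W) A2"
    (is "?L \<longleftrightarrow> ?R")
proof
  have rVW: "r \<in> V - W" using r W by blast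
  {
    assume L: ?L
    have "B \<noteq> {}"
    proof
      assume "B = {}"
      moreover have "adj_closed (A1 \<union> A2) W"
        using adj_closed_Un_disjoint[OF A1(1), of A2] A2 by blast
      moreover obtain w where "w \<in> W" using W by blast
      ultimately have "V \<subseteq> W"
        using spanning_connected_subset[of V "A1 \<union> A2" W w] L W by auto
      then show False using rVW by blast
    qed
    moreover have "spanning_connected (V - W) A2"
      unfolding spanning_connected_iff[OF rVW]
    proof (intro allI impI, elim conjE)
      fix U assume U: "adj_closed A2 U" "r \<in> U"
      let ?U = "W \<union> (U \<inter> (V - W))"
      have "adj_closed B ?U" unfolding adj_closed_def
      proof (intro allI impI)
        fix x y assume "{x, y} \<in> B"
        then obtain w where "w \<in> W" "{x, y} = {r, w}" using B by blast
        then have "y = r \<or> y \<in> W" by (auto simp: doubleton_eq_iff)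
        then show "y \<in> ?U" using U(2) rVW by auto
      qed
      then have "adj_closed (A1 \<union> (A2 \<union> B)) ?U"
        using adj_closed_Un_Int[OF A1(1) A2 U(1)] by simp
      from spanning_connected_subset[OF L this _ r] U(2) rVW have "V \<subseteq> ?U" by simp
      then show "V - W \<subseteq> U" by auto
    qed
    ultimately show ?R by simp
  }
  assume R: ?R
  then obtain e where "e \<in> B" by blast
  with B obtain w where w: "w \<in> W" "{r, w} \<in> B" by metis
  show ?L unfolding spanning_connected_iff[OF r]
  proof (intro allI impI, elim conjE)
    fix U assume U: "adj_closed (A1 \<union> (A2 \<union> B)) U" "r \<in> U"
    then have cl: "adj_closed A1 U" "adj_closed A2 U" "adj_closed B U" by simp_all
    have "V - W \<subseteq> U" using spanning_connected_subset[OF conjunct2[OF R] cl(2) U(2) rVW] .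
    moreover have "w \<in> U" using adj_closedD[OF cl(3) w(2) U(2)] .
    then have "W \<subseteq> U" using spanning_connected_subset[OF A1(2) cl(1) _ w(1)] by simp
    ultimately show "V \<subseteq> U" by auto
  qed
qed

definition cross_edges :: "nat set set \<Rightarrow> nat \<Rightarrow> nat set \<Rightarrow> nat set set" where
  "cross_edges E r W = {e \<in> E. r \<in> e \<and> e \<inter> W \<noteq> {}}"

lemma cross_edges_pair:
  assumes "simple_graph V E" "r \<notin> W" "e \<in> cross_edges E r W"
  shows "\<exists>w\<in>W. e = {r, w}"
proof -
  have "card e = 2" "r \<in> e" "e \<inter> W \<noteq> {}"
    using assms simple_graph_edge_card[OF assms(1)] unfolding cross_edges_def by auto
  then obtain w where "w \<in> e" "w \<in> W" by blast
  moreover from this have "w \<noteq> r" using assms(2) by blast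
  ultimately have "e = {r, w}"
    using \<open>card e = 2\<close> \<open>r \<in> e\<close> unfolding card_2_iff by blast
  then show ?thesis using \<open>w \<in> W\<close> by blast
qed

lemma component_complement_delete:
  assumes G: "simple_graph V E" and W: "W \<subseteq> V - {r}"
  shows "{e \<in> E. \<not> (e \<subseteq> V - {r} \<and> e \<inter> W \<noteq> {})} = induced E (V - W) \<union> cross_edges E r W"
    "induced E (V - W) \<inter> cross_edges E r W = {}"
proof -
  have "e \<subseteq> V - {r} \<and> e \<inter> W \<noteq> {} \<longleftrightarrow> \<not> (e \<subseteq> V - W) \<and> \<not> (r \<in> e \<and> e \<inter> W \<noteq> {})"
    if "e \<in> E" for e
    using simple_graph_edge_subset[OF G that] by blast
  then show "{e \<in> E. \<not> (e \<subseteq> V - {r} \<and> e \<inter> W \<noteq> {})} = induced E (V - W) \<union> cross_edges E r W"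
    unfolding induced_def cross_edges_def by auto
  show "induced E (V - W) \<inter> cross_edges E r W = {}"
    unfolding induced_def cross_edges_def by auto
qed

lemma induced_cross_disjoint:
  assumes "r \<notin> W"
  shows "induced E W \<inter> cross_edges E r W = {}"
  using assms unfolding induced_def cross_edges_def by auto

text \<open>The attaching edges may be any nonempty subset of the \<open>k\<close> edges from
  \<open>r\<close> to \<open>W\<close>, which contributes \<open>(1 + v) ^ k - 1\<close>. This is
  the factor whose sign is controlled when \<open>\<bar>1 + v\<bar> < 1\<close>.\<close>

lemma conn_poly_recursion:
  assumes G: "simple_graph V E" and r: "r \<in> V" and x: "x \<in> V - {r}"
  shows "conn_poly V E v = (\<Sum>W | W \<subseteq> V - {r} \<and> x \<in> W. conn_poly W (induced E W) v *
    (((1 + v) ^ card (cross_edges E r W) - 1) * conn_poly (V - W) (induced E (V - W)) v))"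
proof -
  note fin = finite_simple_graph[OF G]
  have pairs: "\<forall>e\<in>E. card e = 2" using simple_graph_edge_card[OF G] by blast
  have finV: "finite (V - {r})" using simple_graph_finite_vertices[OF G] by simp
  let ?R = "\<lambda>W. {e \<in> E. \<not> (e \<subseteq> V - {r} \<and> e \<inter> W \<noteq> {})}"
  let ?X = "cross_edges E r"
  have finX: "finite (?X W)" for W using fin unfolding cross_edges_def by simp
  let ?g = "\<lambda>A. of_bool (spanning_connected V A) :: real"
  let ?h = "\<lambda>W A. of_bool (A \<inter> ?X W \<noteq> {} \<and> spanning_connected (V - W) (A \<inter> induced E (V - W))) :: real"
  have factor: "(\<Sum>A1 | A1 \<subseteq> induced E W \<and> spanning_connected W A1.
       \<Sum>A2\<in>Pow (?R W). ?g (A1 \<union> A2) * v ^ card (A1 \<union> A2)) =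
     conn_poly W (induced E W) v * (\<Sum>A2\<in>Pow (?R W). ?h W A2 * v ^ card A2)"
    if W: "W \<in> {W. W \<subseteq> V - {r} \<and> x \<in> W}" for W
  proof (rule component_sum_factor[OF fin])
    have rW: "r \<notin> W" "W \<subseteq> V - {r}" using W by auto
    show "finite (?R W)" using fin by simp
    show "induced E W \<inter> ?R W = {}"
      unfolding component_complement_delete[OF G rW(2)] Int_Un_distrib
      using induced_disjoint[OF G] induced_cross_disjoint[OF rW(1)] by simp
    fix A1 A2 assume A: "A1 \<subseteq> induced E W" "spanning_connected W A1" "A2 \<subseteq> ?R W"
    have A2: "A2 = (A2 \<inter> induced E (V - W)) \<union> (A2 \<inter> ?X W)"
      using A(3) unfolding component_complement_delete[OF G rW(2)] by blast
    have B: "\<forall>e\<in>A2 \<inter> ?X W. \<exists>w\<in>W. e = {r, w}" using cross_edges_pair[OF G rW(1)] by blast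
    have U: "\<Union>A1 \<subseteq> W" "\<Union>(A2 \<inter> induced E (V - W)) \<subseteq> V - W"
      using A(1) unfolding induced_def by auto
    have "W \<noteq> {}" using W by auto
    from connected_component_iff[OF rW(2) this r U(1) A(2) U(2) B, folded A2]
    show "?g (A1 \<union> A2) = ?h W A2" by simp
  qed
  have inner: "(\<Sum>A2\<in>Pow (?R W). ?h W A2 * v ^ card A2) =
      conn_poly (V - W) (induced E (V - W)) v * ((1 + v) ^ card (?X W) - 1)"
    if W: "W \<in> {W. W \<subseteq> V - {r} \<and> x \<in> W}" for W
  proof -
    have WV: "W \<subseteq> V - {r}" using W by simp
    note disj = component_complement_delete(2)[OF G WV]
    have eq: "?h W (A \<union> B) * v ^ card (A \<union> B) =
        (of_bool (spanning_connected (V - W) A) * v ^ card A) * (of_bool (B \<noteq> {}) * v ^ card B)"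
      if AB: "A \<in> Pow (induced E (V - W))" "B \<in> Pow (?X W)" for A B
    proof -
      have "(A \<union> B) \<inter> ?X W = B" "(A \<union> B) \<inter> induced E (V - W) = A"
        using AB disj by blast+
      then show ?thesis
        using card_Un_Pow[OF finite_induced[OF fin] finX disj AB] by (simp add: power_add)
    qed
    have "(\<Sum>B\<in>Pow (?X W). of_bool (B \<noteq> {}) * v ^ card B) = (1 + v) ^ card (?X W) - 1"
    proof -
      have "(\<Sum>B\<in>Pow (?X W). v ^ card B) = (\<Sum>B\<in>Pow (?X W). of_bool (B \<noteq> {}) * v ^ card B + of_bool (B = {}))"
        by (intro sum.cong) auto
      also have "\<dots> = (\<Sum>B\<in>Pow (?X W). of_bool (B \<noteq> {}) * v ^ card B) + 1"
        unfolding sum.distrib using finX[of W] by simp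
      finally show ?thesis using sum_Pow_power[OF finX] by simp
    qed
    moreover have "(\<Sum>A2\<in>Pow (?R W). ?h W A2 * v ^ card A2) =
      (\<Sum>A\<in>Pow (induced E (V - W)). of_bool (spanning_connected (V - W) A) * v ^ card A) *
      (\<Sum>B\<in>Pow (?X W). of_bool (B \<noteq> {}) * v ^ card B)"
      unfolding component_complement_delete(1)[OF G WV]
        sum_Pow_disjoint_Un[OF finite_induced[OF fin] finX disj] sum_product
      by (intro sum.cong refl eq)
    ultimately show ?thesis
      unfolding conn_poly_of_bool[OF finite_induced[OF fin]] by simp
  qed
  have "conn_poly V E v = (\<Sum>A\<in>Pow E. ?g A * v ^ card A)"
    by (rule conn_poly_of_bool[OF fin])
  also have "\<dots> = (\<Sum>W | W \<subseteq> V - {r} \<and> x \<in> W. \<Sum>A1 | A1 \<subseteq> induced E W \<and> spanning_connected W A1.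
       \<Sum>A2\<in>Pow (?R W). ?g (A1 \<union> A2) * v ^ card (A1 \<union> A2))"
    by (rule component_decomposition[OF fin finV x pairs])
  also have "\<dots> = (\<Sum>W | W \<subseteq> V - {r} \<and> x \<in> W. conn_poly W (induced E W) v *
    (((1 + v) ^ card (?X W) - 1) * conn_poly (V - W) (induced E (V - W)) v))"
    using factor inner by (intro sum.cong refl) (simp only: mult.commute)
  finally show ?thesis .
qed


section \<open>Real roots lie in [-1, 0] or equal 1\<close>

lemma conn_poly_singleton:
  assumes "simple_graph {x} E"
  shows "conn_poly {x} E v = 1"
proof -
  have "E = {}"
  proof (rule equals0I)
    fix e assume "e \<in> E"
    then have "e \<subseteq> {x}" "card e = 2"
      using simple_graph_edge_subset[OF assms] simple_graph_edge_card[OF assms] by auto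
    then show False using card_mono[of "{x}" e] by simp
  qed
  then show ?thesis unfolding conn_poly_def by (simp add: Collect_conv_if)
qed

text \<open>Supplies a term of the recursion that does not vanish: take the component of
  \<open>x\<close> in the full graph with \<open>r\<close> deleted. Connectedness of the graph
  forces an edge from \<open>r\<close> to it and a connected remainder.\<close>

lemma connected_component_exists:
  assumes G: "simple_graph V E" and sc: "spanning_connected V E" and r: "r \<in> V" and x: "x \<in> V - {r}"
  shows "\<exists>W. W \<subseteq> V - {r} \<and> x \<in> W \<and> spanning_connected W (induced E W) \<and>
    cross_edges E r W \<noteq> {} \<and> spanning_connected (V - W) (induced E (V - W))"
proof -
  have pairs: "\<forall>e\<in>E. card e = 2" using simple_graph_edge_card[OF G] by blast
  define W where "W = component (induced E (V - {r})) x"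
  note W = component_induced[OF pairs x, folded W_def]
  have "W \<noteq> {}" "r \<notin> W" using W by auto
  have U: "\<Union>(induced E W) \<subseteq> W" "\<Union>(induced E (V - W)) \<subseteq> V - W"
    unfolding induced_def by auto
  have B: "\<forall>e\<in>cross_edges E r W. \<exists>w\<in>W. e = {r, w}"
    using cross_edges_pair[OF G \<open>r \<notin> W\<close>] by blast
  have E: "E = induced E W \<union> (induced E (V - W) \<union> cross_edges E r W)"
  proof (intro equalityI subsetI)
    fix e assume e: "e \<in> E"
    show "e \<in> induced E W \<union> (induced E (V - W) \<union> cross_edges E r W)"
    proof (cases "e \<subseteq> V - {r} \<and> e \<inter> W \<noteq> {}")
      case True
      then have "e \<in> induced E W" using W(4)[OF e] e unfolding induced_def by simp
      then show ?thesis by simp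
    next
      case False
      then have "e \<in> {e \<in> E. \<not> (e \<subseteq> V - {r} \<and> e \<inter> W \<noteq> {})}" using e by simp
      then show ?thesis unfolding component_complement_delete(1)[OF G W(1)] by simp
    qed
  qed (auto simp: induced_def cross_edges_def)
  have "spanning_connected V (induced E W \<union> (induced E (V - W) \<union> cross_edges E r W))"
    by (subst E[symmetric]) (rule sc)
  then have "cross_edges E r W \<noteq> {} \<and> spanning_connected (V - W) (induced E (V - W))"
    using connected_component_iff[OF W(1) \<open>W \<noteq> {}\<close> r U(1) W(3) U(2) B] by simp
  then show ?thesis using W(1-3) by (intro exI[of _ W]) simp
qed

text \<open>All terms of the recursion share one sign: those of \<open>W\<close> and
  \<open>V - W\<close> multiply, and the nonpositive factor \<open>(1 + v) ^ k - 1\<close> adds one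
  more sign change. The weak inequality is carried along because the pieces in the sum may be
  disconnected.\<close>

lemma conn_poly_sign:
  assumes "simple_graph V E" "V \<noteq> {}" "\<bar>1 + v\<bar> < 1"
  shows "0 \<le> (-1) ^ (card V - 1) * conn_poly V E v \<and>
    (spanning_connected V E \<longrightarrow> 0 < (-1) ^ (card V - 1) * conn_poly V E v)"
  using assms(1,2)
proof (induction "card V" arbitrary: V E rule: less_induct)
  case less
  note G = less.prems(1)
  note finV = simple_graph_finite_vertices[OF G]
  have finE: "finite E" by (rule finite_simple_graph[OF G])
  obtain r where r: "r \<in> V" using less.prems(2) by blast
  show ?case
  proof (cases "V = {r}")
    case True
    then show ?thesis using conn_poly_singleton[of r E v] G by simp
  next
    case False
    then obtain x where x: "x \<in> V - {r}" using r by blast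
    let ?s = "\<lambda>W. (-1) ^ (card W - 1) * conn_poly W (induced E W) v"
    let ?d = "\<lambda>W. 1 - (1 + v) ^ card (cross_edges E r W)"
    let ?S = "{W. W \<subseteq> V - {r} \<and> x \<in> W}"
    have IH: "0 \<le> ?s W \<and> (spanning_connected W (induced E W) \<longrightarrow> 0 < ?s W)"
      if "W \<subseteq> V" "W \<noteq> V" "W \<noteq> {}" for W
      using less.hyps[of W "induced E W"] simple_graph_induced[OF G that(1)] that
        psubset_card_mono[OF finV, of W] by blast
    have IH1: "0 \<le> ?s W \<and> (spanning_connected W (induced E W) \<longrightarrow> 0 < ?s W)"
      and IH2: "0 \<le> ?s (V - W) \<and> (spanning_connected (V - W) (induced E (V - W)) \<longrightarrow> 0 < ?s (V - W))"
      if "W \<in> ?S" for W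
      using that r by (intro IH; blast)+
    have d: "0 \<le> ?d W \<and> (cross_edges E r W \<noteq> {} \<longrightarrow> 0 < ?d W)" for W
    proof (cases "cross_edges E r W = {}")
      case False
      have "finite (cross_edges E r W)" using finE unfolding cross_edges_def by simp
      then have "\<bar>1 + v\<bar> ^ card (cross_edges E r W) < 1"
        using False assms(3) by (simp add: power_less_one_iff card_gt_0_iff)
      then show ?thesis by (simp add: power_abs[symmetric] abs_less_iff)
    qed simp
    have prod_eq: "(-1) ^ (card V - 1) * (conn_poly W (induced E W) v *
      (((1 + v) ^ card (cross_edges E r W) - 1) * conn_poly (V - W) (induced E (V - W)) v))
      = ?s W * ?d W * ?s (V - W)" if W: "W \<in> ?S" for W
    proof -
      have WV: "W \<subseteq> V" "W \<noteq> {}" using W by auto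
      moreover have "finite W" using finite_subset[OF WV(1) finV] .
      moreover have "V - W \<noteq> {}" using W r by blast
      then have "card (V - W) \<noteq> 0" using finV by simp
      \<comment> \<open>Both pieces are nonempty, so the truncated subtractions are genuine, and the
        \<open>Suc\<close> is the extra sign change.\<close>
      ultimately have "card V - 1 = Suc ((card W - 1) + (card (V - W) - 1))"
        using card_Diff_subset[of W V] card_mono[OF finV, of W] card_gt_0_iff[of W] by linarith
      then have "(-1 :: real) ^ (card V - 1) = - ((-1) ^ (card W - 1) * (-1) ^ (card (V - W) - 1))"
        by (simp add: power_add)
      then show ?thesis by (simp add: algebra_simps)
    qed
    have eq: "(-1) ^ (card V - 1) * conn_poly V E v = (\<Sum>W\<in>?S. ?s W * ?d W * ?s (V - W))"
      unfolding conn_poly_recursion[OF G r x] sum_distrib_left by (intro sum.cong refl prod_eq)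
    have nonneg: "0 \<le> ?s W * ?d W * ?s (V - W)" if "W \<in> ?S" for W
      by (rule mult_nonneg_nonneg[OF mult_nonneg_nonneg[OF
            conjunct1[OF IH1[OF that]] conjunct1[OF d]] conjunct1[OF IH2[OF that]]])
    show ?thesis unfolding eq
    proof (intro conjI impI)
      show "0 \<le> (\<Sum>W\<in>?S. ?s W * ?d W * ?s (V - W))" by (rule sum_nonneg) (rule nonneg)
      assume "spanning_connected V E"
      from connected_component_exists[OF G this r x] obtain W where
        W: "W \<in> ?S" "spanning_connected W (induced E W)" "cross_edges E r W \<noteq> {}"
          "spanning_connected (V - W) (induced E (V - W))" by blast
      have "0 < ?s W * ?d W * ?s (V - W)"
        by (rule mult_pos_pos[OF mult_pos_pos[OF mp[OF conjunct2[OF IH1[OF W(1)]] W(2)]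
              mp[OF conjunct2[OF d] W(3)]] mp[OF conjunct2[OF IH2[OF W(1)]] W(4)]])
      then show "0 < (\<Sum>W\<in>?S. ?s W * ?d W * ?s (V - W))"
        using finV by (intro sum_pos2[OF _ W(1)] nonneg) simp_all
    qed
  qed
qed

lemma Rel_root_bounds:
  assumes G: "simple_graph V E" and conn: "connected_graph V E" and root: "Rel V E q = 0"
  shows "q \<in> {-1..0} \<union> {1}"
proof (rule ccontr)
  assume n: "q \<notin> {-1..0} \<union> {1}"
  then have q: "q \<noteq> 0" "q \<noteq> 1" by auto
  let ?v = "(1 - q) / q"
  have V: "V \<noteq> {}" "spanning_connected V E" using conn unfolding connected_graph_def by auto
  have finE: "finite E" by (rule finite_simple_graph[OF G])
  have v: "1 + ?v = 1 / q" using q by (simp add: field_simps)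
  have zero: "conn_poly V E ?v = 0" using root Rel_eq_conn_poly[OF finE q(1)] q(1) by simp
  show False
  proof (cases "0 < q \<and> q < 1")
    case True
    then have "0 < ?v" by simp
    \<comment> \<open>The full edge set \<open>E\<close> is one of the summands and makes the sum
      strictly positive.\<close>
    then have "0 < (\<Sum>A | A \<subseteq> E \<and> spanning_connected V A. ?v ^ card A)"
      using finE V by (intro sum_pos2[of _ E]) (auto intro!: zero_le_power simp del: power_divide)
    then show False using zero unfolding conn_poly_def by simp
  next
    case False
    \<comment> \<open>The cases \<open>q < -1\<close> and \<open>q > 1\<close> are treated together,
      since \<open>1 + v = 1 / q\<close>.\<close>
    with n have "1 < \<bar>q\<bar>" by auto
    then have "\<bar>1 + ?v\<bar> < 1" unfolding v using q by simp
    then show False using conn_poly_sign[OF G V(1)] V(2) zero by fastforce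
  qed
qed


section \<open>Complete graphs\<close>

definition complete_edges :: "nat set \<Rightarrow> nat set set" where
  "complete_edges V = {e. e \<subseteq> V \<and> card e = 2}"

lemma simple_graph_complete: "finite V \<Longrightarrow> simple_graph V (complete_edges V)"
  unfolding simple_graph_def complete_edges_def by simp

lemma induced_complete_edges: "W \<subseteq> V \<Longrightarrow> induced (complete_edges V) W = complete_edges W"
  unfolding induced_def complete_edges_def by auto

lemma card_complete_edges: "finite V \<Longrightarrow> card (complete_edges V) = card V choose 2"
  unfolding complete_edges_def by (rule n_subsets)

lemma spanning_connected_complete: "spanning_connected V (complete_edges V)"
  unfolding spanning_connected_def
proof (intro ballI)
  fix u w assume "u \<in> V" "w \<in> V"
  then show "(u, w) \<in> {(x, y). {x, y} \<in> complete_edges V}\<^sup>*"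
    by (cases "u = w") (auto intro!: r_into_rtrancl simp: complete_edges_def)
qed

lemma sum_subsets_containing:
  fixes g :: "nat \<Rightarrow> real"
  assumes "finite V" "u \<in> V"
  shows "(\<Sum>W | W \<subseteq> V \<and> u \<in> W. g (card W)) =
    (\<Sum>j\<le>card V - 1. (card V - 1 choose j) * g (Suc j))"
proof -
  have "(\<Sum>W | W \<subseteq> V \<and> u \<in> W. g (card W)) = (\<Sum>A\<in>Pow (V - {u}). g (Suc (card A)))"
  proof (rule sum.reindex_bij_witness[of _ "insert u" "\<lambda>W. W - {u}"])
    fix W assume "W \<in> {W. W \<subseteq> V \<and> u \<in> W}"
    moreover from this have "finite W" using assms(1) finite_subset by blast
    ultimately have "Suc (card (W - {u})) = card W" by (intro card_Suc_Diff1) auto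
    then show "g (Suc (card (W - {u}))) = g (card W)" by simp
  qed (use assms in auto)
  then show ?thesis using sum_Pow_card[of "V - {u}" "\<lambda>k. g (Suc k)"] assms by simp
qed

definition complete_conn :: "nat \<Rightarrow> real \<Rightarrow> real" where
  "complete_conn n v = conn_poly {..<n} (complete_edges {..<n}) v"

text \<open>Independence of the vertex names, without isomorphisms: the recursion for the total
  weight determines the connected sum from smaller complete graphs, whose values depend only on
  their size by induction.\<close>

lemma conn_poly_complete:
  assumes "finite V" "V \<noteq> {}"
  shows "conn_poly V (complete_edges V) v = complete_conn (card V) v"
  using assms
proof (induction "card V" arbitrary: V rule: less_induct)
  case less
  define g where "g k = complete_conn k v * (1 + v) ^ ((card V - k) choose 2)" for k
  \<comment> \<open>The term \<open>W = U\<close> is split off, and \<open>g (card V)\<close> is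
    subtracted because the sum over sizes includes it. The same equation then holds for
    \<open>V\<close> and for \<open>{..<card V}\<close>, and comparing the two gives the
    claim.\<close>
  have X: "conn_poly U (complete_edges U) v + ((\<Sum>j\<le>card V - 1. (card V - 1 choose j) * g (Suc j))
      - g (card V)) = (1 + v) ^ (card V choose 2)" if U: "finite U" "card U = card V" for U
  proof -
    have "U \<noteq> {}" using U less.prems by auto
    then obtain u where u: "u \<in> U" by blast
    let ?t = "\<lambda>W. conn_poly W (induced (complete_edges U) W) v *
        (1 + v) ^ card (induced (complete_edges U) (U - W))"
    have t: "?t W = g (card W)" if W: "W \<subseteq> U" "u \<in> W" "W \<noteq> U" for W
    proof -
      have "finite W" "card W < card U" "W \<noteq> {}"
        using W U(1) psubset_card_mono[OF U(1), of W] finite_subset[OF W(1) U(1)] by auto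
      then have "conn_poly W (complete_edges W) v = complete_conn (card W) v"
        using less.hyps[of W] U by simp
      moreover have "card (complete_edges (U - W)) = (card V - card W) choose 2"
        using card_complete_edges[of "U - W"] U \<open>finite W\<close> W by (simp add: card_Diff_subset)
      ultimately show ?thesis using W by (simp add: induced_complete_edges g_def)
    qed
    have tU: "?t U = conn_poly U (complete_edges U) v"
      using card_complete_edges[of "{}"] by (simp add: induced_complete_edges numeral_2_eq_2)
    have fin: "finite {W. W \<subseteq> U \<and> u \<in> W}" using U by simp
    have UU: "U \<in> {W. W \<subseteq> U \<and> u \<in> W}" using u by simp
    have "(1 + v) ^ (card V choose 2) = (\<Sum>W | W \<subseteq> U \<and> u \<in> W. ?t W)"
      using power_card_edges_recursion[OF simple_graph_complete[OF U(1)] u, of v]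
        card_complete_edges[OF U(1)] U(2) by simp
    also have "\<dots> = ?t U + (\<Sum>W\<in>{W. W \<subseteq> U \<and> u \<in> W} - {U}. ?t W)"
      by (rule sum.remove[OF fin UU])
    also have "(\<Sum>W\<in>{W. W \<subseteq> U \<and> u \<in> W} - {U}. ?t W) =
        (\<Sum>W\<in>{W. W \<subseteq> U \<and> u \<in> W} - {U}. g (card W))"
      by (intro sum.cong refl t) auto
    also have "\<dots> = (\<Sum>W | W \<subseteq> U \<and> u \<in> W. g (card W)) - g (card U)"
      using sum.remove[OF fin UU, of "\<lambda>W. g (card W)"] by simp
    also have "(\<Sum>W | W \<subseteq> U \<and> u \<in> W. g (card W)) =
        (\<Sum>j\<le>card V - 1. (card V - 1 choose j) * g (Suc j))"
      using sum_subsets_containing[OF U(1) u, of g] U(2) by simp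
    finally show ?thesis using tU U(2) by simp
  qed
  show ?case
    using X[OF less.prems(1) refl] X[of "{..<card V}"] unfolding complete_conn_def by simp
qed

text \<open>The weighted form of the classical recursion for labelled connected graphs;
  \<open>Suc j\<close> is the size of the component of a fixed vertex.\<close>

lemma complete_conn_recursion:
  "(1 + v) ^ (Suc m choose 2) =
    (\<Sum>j\<le>m. (m choose j) * (complete_conn (Suc j) v * (1 + v) ^ ((m - j) choose 2)))"
proof -
  let ?V = "{..<Suc m}"
  let ?g = "\<lambda>k. complete_conn k v * (1 + v) ^ ((Suc m - k) choose 2)"
  have u: "0 \<in> ?V" by simp
  have "(1 + v) ^ (Suc m choose 2) = (\<Sum>W | W \<subseteq> ?V \<and> 0 \<in> W. conn_poly W (induced (complete_edges ?V) W) v *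
        (1 + v) ^ card (induced (complete_edges ?V) (?V - W)))"
    using power_card_edges_recursion[OF simple_graph_complete u, of v] card_complete_edges[of ?V] by simp
  also have "\<dots> = (\<Sum>W | W \<subseteq> ?V \<and> 0 \<in> W. ?g (card W))"
  proof (intro sum.cong refl)
    fix W assume W: "W \<in> {W. W \<subseteq> ?V \<and> 0 \<in> W}"
    then have "finite W" "W \<noteq> {}" using finite_subset[of W ?V] by auto
    then show "conn_poly W (induced (complete_edges ?V) W) v *
        (1 + v) ^ card (induced (complete_edges ?V) (?V - W)) = ?g (card W)"
      using W by (simp add: induced_complete_edges conn_poly_complete card_complete_edges card_Diff_subset)
  qed
  also have "\<dots> = (\<Sum>j\<le>m. (m choose j) * ?g (Suc j))"
    using sum_subsets_containing[of ?V 0 ?g] by simp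
  finally show ?thesis by simp
qed

text \<open>Here \<open>m\<close> counts the vertices other than the two terminals, and
  \<open>j\<close> of them lie on the side of \<open>u\<close>.\<close>

lemma split_poly_complete:
  assumes V: "finite V" "card V = m + 2" and ub: "u \<in> V" "b \<in> V" "u \<noteq> b"
  shows "split_poly V (complete_edges V) u b v =
    (\<Sum>j\<le>m. (m choose j) * (complete_conn (Suc j) v * complete_conn (Suc m - j) v))"
proof -
  let ?g = "\<lambda>k. complete_conn k v * complete_conn (m + 2 - k) v"
  have set: "{W. W \<subseteq> V \<and> u \<in> W \<and> b \<notin> W} = {W. W \<subseteq> V - {b} \<and> u \<in> W}" by blast
  have "split_poly V (complete_edges V) u b v = (\<Sum>W | W \<subseteq> V - {b} \<and> u \<in> W.
    conn_poly W (induced (complete_edges V) W) v * conn_poly (V - W) (induced (complete_edges V) (V - W)) v)"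
    unfolding split_poly_recursion[OF simple_graph_complete[OF V(1)] ub(1,2)] set ..
  also have "\<dots> = (\<Sum>W | W \<subseteq> V - {b} \<and> u \<in> W. ?g (card W))"
  proof (intro sum.cong refl)
    fix W assume "W \<in> {W. W \<subseteq> V - {b} \<and> u \<in> W}"
    then have W: "W \<subseteq> V" "W \<noteq> {}" "V - W \<noteq> {}" "finite W"
      using ub V(1) finite_subset[of W V] by auto
    then show "conn_poly W (induced (complete_edges V) W) v *
        conn_poly (V - W) (induced (complete_edges V) (V - W)) v = ?g (card W)"
      using V by (simp add: induced_complete_edges conn_poly_complete card_Diff_subset)
  qed
  also have "\<dots> = (\<Sum>j\<le>m. (m choose j) * ?g (Suc j))"
    using sum_subsets_containing[of "V - {b}" u ?g] V ub by simp
  finally show ?thesis by simp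
qed

lemma continuous_conn_poly: "continuous_on A (\<lambda>y. conn_poly V E (y - 1))"
  unfolding conn_poly_def by (intro continuous_intros)


section \<open>Asymptotics for complete graphs\<close>

text \<open>Pairs in a union of two disjoint sets: inside the first, inside the second, or
  across.\<close>

lemma choose_two_add: "(a + b) choose 2 = (a choose 2) + (b choose 2) + a * b"
proof (induction b)
  case (Suc b)
  have "Suc k choose 2 = k + (k choose 2)" for k by (simp add: numeral_2_eq_2)
  with Suc show ?case by simp
qed (simp add: numeral_2_eq_2)

text \<open>If \<open>i\<close> is the smaller of \<open>j\<close> and \<open>m - j\<close>, the
  exponent is at least \<open>m * i / 2\<close>, so the power is at most \<open>p ^ i\<close> with
  \<open>p = sqrt t ^ m\<close>. Against the binomial coefficients these sum to at most
  \<open>(1 + p) ^ m - 1\<close>, which vanishes because \<open>m * p\<close> does.\<close>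

lemma binomial_tail_tendsto_zero:
  fixes t :: real
  assumes t: "0 < t" "t < 1"
  shows "(\<lambda>m. \<Sum>j=1..<m. (m choose j) * t ^ (j * (m - j))) \<longlonglongrightarrow> 0"
proof (rule real_tendsto_sandwich)
  define s where "s = sqrt t"
  have s: "0 < s" "s < 1" "t = s ^ 2" using t by (auto simp: s_def)
  show "\<forall>\<^sub>F m in sequentially. 0 \<le> (\<Sum>j=1..<m. (m choose j) * t ^ (j * (m - j)))"
    using t by (intro always_eventually allI sum_nonneg) simp
  have bound: "(\<Sum>j=1..<m. (m choose j) * t ^ (j * (m - j))) \<le> 2 * ((1 + s ^ m) ^ m - 1)" for m
  proof -
    define p where "p = s ^ m"
    have p: "0 \<le> p" using s by (simp add: p_def)
    have binom: "(\<Sum>j\<le>m. (m choose j) * p ^ j) = (1 + p) ^ m"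
      using binomial_ring[of p 1 m] by (simp add: add.commute)
    have tail: "(\<Sum>j=1..<m. (m choose j) * p ^ j) \<le> (1 + p) ^ m - 1"
    proof -
      have "1 + (\<Sum>j=1..<m. (m choose j) * p ^ j) = (\<Sum>j\<in>insert 0 {1..<m}. (m choose j) * p ^ j)"
        by simp
      also have "\<dots> \<le> (\<Sum>j\<le>m. (m choose j) * p ^ j)"
        by (rule sum_mono2) (use p in auto)
      finally show ?thesis using binom by simp
    qed
    have swap: "(\<Sum>j=1..<m. (m choose j) * p ^ (m - j)) = (\<Sum>j=1..<m. (m choose j) * p ^ j)"
      by (rule sum.reindex_bij_witness[of _ "\<lambda>j. m - j" "\<lambda>j. m - j"])
        (auto simp: binomial_symmetric[symmetric])
    \<comment> \<open>Adding the bounds for both cases gives a summand symmetric in \<open>j\<close>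
      and \<open>m - j\<close>; this is the source of the factor 2.\<close>
    have "t ^ (j * (m - j)) \<le> p ^ j + p ^ (m - j)" if j: "j \<in> {1..<m}" for j
    proof (cases "2 * j \<le> m")
      case True
      have "t ^ (j * (m - j)) = s ^ (2 * (j * (m - j)))" by (simp add: s(3) power_mult)
      also have "\<dots> \<le> s ^ (m * j)"
      proof (rule power_decreasing)
        have "m * j \<le> (2 * (m - j)) * j" using True by (intro mult_right_mono) auto
        then show "m * j \<le> 2 * (j * (m - j))" by (simp add: mult_ac)
      qed (use s in auto)
      also have "\<dots> = p ^ j" by (simp add: p_def power_mult)
      finally show ?thesis using p by (simp add: add_increasing2)
    next
      case False
      have "t ^ (j * (m - j)) = s ^ (2 * (j * (m - j)))" by (simp add: s(3) power_mult)
      also have "\<dots> \<le> s ^ (m * (m - j))"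
      proof (rule power_decreasing)
        have "m * (m - j) \<le> (2 * j) * (m - j)" using False by (intro mult_right_mono) auto
        then show "m * (m - j) \<le> 2 * (j * (m - j))" by (simp add: mult_ac)
      qed (use s in auto)
      also have "\<dots> = p ^ (m - j)" by (simp add: p_def power_mult)
      finally show ?thesis using p by (simp add: add_increasing)
    qed
    then have "(\<Sum>j=1..<m. (m choose j) * t ^ (j * (m - j)))
        \<le> (\<Sum>j=1..<m. (m choose j) * (p ^ j + p ^ (m - j)))"
      by (intro sum_mono mult_left_mono) auto
    also have "\<dots> = 2 * (\<Sum>j=1..<m. (m choose j) * p ^ j)"
      using swap by (simp add: distrib_left sum.distrib)
    finally show ?thesis using tail unfolding p_def by simp
  qed
  then show "\<forall>\<^sub>F m in sequentially. (\<Sum>j=1..<m. (m choose j) * t ^ (j * (m - j)))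
      \<le> 2 * (exp (m * s ^ m) - 1)"
  proof (intro always_eventually allI)
    fix m
    have "(1 + s ^ m) ^ m \<le> exp (s ^ m) ^ m"
      using s exp_ge_add_one_self[of "s ^ m"] by (intro power_mono) auto
    also have "\<dots> = exp (m * s ^ m)" by (simp add: exp_of_nat_mult)
    finally show "(\<Sum>j=1..<m. (m choose j) * t ^ (j * (m - j))) \<le> 2 * (exp (m * s ^ m) - 1)"
      using bound[of m] by simp
  qed
  have "(\<lambda>m. of_nat m * s ^ m) \<longlonglongrightarrow> 0" using s by (intro powser_times_n_limit_0) auto
  then have "(\<lambda>m. 2 * (exp (m * s ^ m) - 1)) \<longlonglongrightarrow> 2 * (exp 0 - 1)"
    by (intro tendsto_intros)
  then show "(\<lambda>m. 2 * (exp (m * s ^ m) - 1)) \<longlonglongrightarrow> 0" by simp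
qed simp

text \<open>For \<open>\<bar>y\<bar> > 1\<close> the connected subsets of the complete graph carry almost all the weight,
  and the cheapest way to separate two terminals is to isolate one of them.\<close>
context
  fixes y :: real
  assumes y: "1 < \<bar>y\<bar>"
begin

text \<open>All edge subsets together weigh \<open>y ^ (n choose 2)\<close>, so this is the
  connected share. It is no probability, since the weights may be negative.\<close>

private definition \<rho> :: "nat \<Rightarrow> real" where
  "\<rho> n = complete_conn n (y - 1) / y ^ (n choose 2)"

private definition t :: real where "t = 1 / \<bar>y\<bar>"

private lemma t_bounds: "0 < t" "t < 1"
  using y by (auto simp: t_def)

private lemma y_nonzero: "y \<noteq> 0" using y by auto

private lemma complete_conn_eq: "complete_conn n (y - 1) = \<rho> n * y ^ (n choose 2)"
  using y_nonzero by (simp add: \<rho>_def)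

text \<open>Division of the recursion by the total weight leaves \<open>Suc j * (m - j)\<close> in
  the exponent, the number of absent edges between the component and its complement.\<close>

private lemma rho_recursion: "\<rho> (Suc m) = 1 - (\<Sum>j<m. (m choose j) * \<rho> (Suc j) / y ^ (Suc j * (m - j)))"
proof -
  have summand: "(m choose j) * (complete_conn (Suc j) (y - 1) * y ^ ((m - j) choose 2)) =
    (m choose j) * \<rho> (Suc j) / y ^ (Suc j * (m - j)) * y ^ (Suc m choose 2)" if "j \<le> m" for j
  proof -
    have "Suc m choose 2 = (Suc j choose 2) + ((m - j) choose 2) + Suc j * (m - j)"
      using choose_two_add[of "Suc j" "m - j"] that by simp
    then show ?thesis using y_nonzero by (simp add: complete_conn_eq power_add)
  qed
  have "y ^ (Suc m choose 2) =
      (\<Sum>j\<le>m. (m choose j) * \<rho> (Suc j) / y ^ (Suc j * (m - j))) * y ^ (Suc m choose 2)"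
    using complete_conn_recursion[of "y - 1" m] summand unfolding sum_distrib_right by simp
  then have "1 = (\<Sum>j\<le>m. (m choose j) * \<rho> (Suc j) / y ^ (Suc j * (m - j)))"
    using y_nonzero by simp
  also have "\<dots> = (\<Sum>j<m. (m choose j) * \<rho> (Suc j) / y ^ (Suc j * (m - j))) + \<rho> (Suc m)"
    by (simp add: lessThan_Suc_atMost[symmetric])
  finally show ?thesis by simp
qed

private definition \<delta> :: "nat \<Rightarrow> real" where
  "\<delta> m = (\<Sum>j=1..<m. (m choose j) * t ^ (j * (m - j)))"

private lemma delta_tendsto: "\<delta> \<longlonglongrightarrow> 0"
  using binomial_tail_tendsto_zero[OF t_bounds] unfolding \<delta>_def .

text \<open>The term \<open>j = 0\<close>, an isolated vertex, gives \<open>t ^ m\<close>; in the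
  other terms the exponent is at least \<open>j * (m - j)\<close>, so they are absorbed by
  \<open>\<delta> m\<close>.\<close>

private lemma rho_error:
  assumes M: "\<And>j. j < m \<Longrightarrow> \<bar>\<rho> (Suc j)\<bar> \<le> M" and M0: "0 \<le> M"
  shows "\<bar>\<rho> (Suc m) - 1\<bar> \<le> M * (t ^ m + \<delta> m)"
proof -
  have "\<bar>\<rho> (Suc m) - 1\<bar> = \<bar>\<Sum>j<m. (m choose j) * \<rho> (Suc j) / y ^ (Suc j * (m - j))\<bar>"
    unfolding rho_recursion[of m] by simp
  also have "\<dots> \<le> (\<Sum>j<m. \<bar>(m choose j) * \<rho> (Suc j) / y ^ (Suc j * (m - j))\<bar>)"
    by (rule sum_abs)
  also have "\<dots> \<le> (\<Sum>j<m. M * ((m choose j) * t ^ (Suc j * (m - j))))"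
  proof (rule sum_mono)
    fix j assume j: "j \<in> {..<m}"
    have "\<bar>(m choose j) * \<rho> (Suc j) / y ^ (Suc j * (m - j))\<bar>
        = \<bar>\<rho> (Suc j)\<bar> * ((m choose j) * t ^ (Suc j * (m - j)))"
      by (simp add: abs_mult power_abs t_def power_one_over field_simps)
    also have "\<dots> \<le> M * ((m choose j) * t ^ (Suc j * (m - j)))"
      using M[of j] j t_bounds by (intro mult_right_mono) auto
    finally show "\<bar>(m choose j) * \<rho> (Suc j) / y ^ (Suc j * (m - j))\<bar>
      \<le> M * ((m choose j) * t ^ (Suc j * (m - j)))" .
  qed
  also have "\<dots> = M * (\<Sum>j<m. (m choose j) * t ^ (Suc j * (m - j)))"
    by (simp add: sum_distrib_left)
  also have "(\<Sum>j<m. (m choose j) * t ^ (Suc j * (m - j))) \<le> t ^ m + \<delta> m"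
  proof (cases "m = 0")
    case True
    then show ?thesis by (simp add: \<delta>_def)
  next
    case False
    then have "{..<m} = insert 0 {1..<m}" by auto
    then have "(\<Sum>j<m. (m choose j) * t ^ (Suc j * (m - j))) =
        t ^ m + (\<Sum>j=1..<m. (m choose j) * t ^ (Suc j * (m - j)))" by simp
    moreover have "(\<Sum>j=1..<m. (m choose j) * t ^ (Suc j * (m - j))) \<le> \<delta> m"
      unfolding \<delta>_def using t_bounds
      by (intro sum_mono mult_left_mono power_decreasing mult_right_mono) auto
    ultimately show ?thesis by simp
  qed
  finally show ?thesis using M0 by (simp add: mult_left_mono)
qed

private lemma error_tendsto: "(\<lambda>m. t ^ m + \<delta> m) \<longlonglongrightarrow> 0"
  using tendsto_add[OF LIMSEQ_realpow_zero[of t] delta_tendsto] t_bounds by simp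

text \<open>A bootstrap: once the error factor is below one half, a bound \<open>M\<close> on the
  earlier values yields \<open>1 + M / 2\<close>, which is again at most \<open>M\<close> as soon as
  \<open>M\<close> is at least 2.\<close>

private lemma rho_bounded: "\<exists>M. \<forall>j. \<bar>\<rho> (Suc j)\<bar> \<le> M"
proof -
  have "\<forall>\<^sub>F m in sequentially. t ^ m + \<delta> m < 1 / 2"
    by (rule order_tendstoD(2)[OF error_tendsto]) simp
  then obtain m0 where m0: "\<And>m. m \<ge> m0 \<Longrightarrow> t ^ m + \<delta> m < 1 / 2"
    unfolding eventually_sequentially by blast
  define M where "M = 2 + (\<Sum>j\<le>m0. \<bar>\<rho> (Suc j)\<bar>)"
  have M2: "2 \<le> M" unfolding M_def by (simp add: sum_nonneg)
  have "\<bar>\<rho> (Suc m)\<bar> \<le> M" for m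
  proof (induction m rule: less_induct)
    case (less m)
    show ?case
    proof (cases "m \<le> m0")
      case True
      then have "\<bar>\<rho> (Suc m)\<bar> \<le> (\<Sum>j\<le>m0. \<bar>\<rho> (Suc j)\<bar>)" by (intro member_le_sum) auto
      then show ?thesis by (simp add: M_def)
    next
      case False
      have "\<bar>\<rho> (Suc m) - 1\<bar> \<le> M * (t ^ m + \<delta> m)" using rho_error[of m M] less M2 by simp
      also have "\<dots> \<le> M * (1 / 2)" using m0[of m] False M2 by (intro mult_left_mono) auto
      finally show ?thesis using M2 by linarith
    qed
  qed
  then show ?thesis by blast
qed

private lemma rho_tendsto: "(\<lambda>m. \<rho> (Suc m)) \<longlonglongrightarrow> 1"
proof -
  obtain M where M: "\<And>j. \<bar>\<rho> (Suc j)\<bar> \<le> M" using rho_bounded by blast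
  have "(\<lambda>m. \<rho> (Suc m) - 1) \<longlonglongrightarrow> 0"
  proof (rule Lim_null_comparison)
    show "\<forall>\<^sub>F m in sequentially. norm (\<rho> (Suc m) - 1) \<le> M * (t ^ m + \<delta> m)"
      using rho_error[of _ M] M order_trans[OF abs_ge_zero M] by simp
    show "(\<lambda>m. M * (t ^ m + \<delta> m)) \<longlonglongrightarrow> 0"
      using tendsto_mult_left[OF error_tendsto, of M] by simp
  qed
  then show ?thesis by (simp add: LIM_zero_iff)
qed

lemma complete_conn_asymptotics:
  "(\<lambda>n. complete_conn n (y - 1) / y ^ (n choose 2)) \<longlonglongrightarrow> 1"
  using rho_tendsto unfolding \<rho>_def by (rule LIMSEQ_imp_Suc)

text \<open>The terms \<open>j = 0\<close> and \<open>j = m\<close> isolate one of the terminals and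
  each equal \<open>\<rho> (Suc m)\<close>, which tends to 1. The remaining terms are dominated by a
  multiple of \<open>\<delta> m\<close>.\<close>

lemma complete_split_asymptotics:
  "(\<lambda>m. (\<Sum>j\<le>m. (m choose j) * (complete_conn (Suc j) (y - 1) * complete_conn (Suc m - j) (y - 1)))
     / y ^ (Suc m choose 2)) \<longlonglongrightarrow> 2"
proof -
  obtain M where M: "\<And>j. \<bar>\<rho> (Suc j)\<bar> \<le> M" using rho_bounded by blast
  have M0: "0 \<le> M" using M[of 0] by linarith
  let ?S = "\<lambda>m. (\<Sum>j\<le>m. (m choose j) *
    (complete_conn (Suc j) (y - 1) * complete_conn (Suc m - j) (y - 1))) / y ^ (Suc m choose 2)"
  let ?T = "\<lambda>m j. (m choose j) * (\<rho> (Suc j) * \<rho> (Suc (m - j))) / y ^ (j * (m - j))"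
  have S: "?S m = (\<Sum>j\<le>m. ?T m j)" for m
    unfolding sum_divide_distrib
  proof (intro sum.cong refl)
    fix j assume "j \<in> {..m}"
    then have j: "j \<le> m" by simp
    have s: "Suc k choose 2 = k + (k choose 2)" for k by (simp add: numeral_2_eq_2)
    have "Suc m choose 2 = (Suc j choose 2) + (Suc (m - j) choose 2) + j * (m - j)"
      using choose_two_add[of j "m - j"] j unfolding s by simp
    then show "(m choose j) * (complete_conn (Suc j) (y - 1) * complete_conn (Suc m - j) (y - 1))
        / y ^ (Suc m choose 2) = ?T m j"
      using y_nonzero j by (simp add: complete_conn_eq power_add Suc_diff_le)
  qed
  have rho1: "\<rho> (Suc 0) = 1" using rho_recursion[of 0] by simp
  have "(\<lambda>m. ?S m - 2 * \<rho> (Suc m)) \<longlonglongrightarrow> 0"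
  proof (rule Lim_null_comparison)
    show "\<forall>\<^sub>F m in sequentially. norm (?S m - 2 * \<rho> (Suc m)) \<le> M * M * \<delta> m"
      \<comment> \<open>For \<open>m > 0\<close> the two extreme terms are distinct.\<close>
      using eventually_gt_at_top[of 0]
    proof eventually_elim
      case (elim m)
      have "{..m} = insert 0 (insert m {1..<m})" using elim by auto
      then have "(\<Sum>j\<le>m. ?T m j) = 2 * \<rho> (Suc m) + (\<Sum>j=1..<m. ?T m j)"
        using elim rho1 by simp
      then have "norm (?S m - 2 * \<rho> (Suc m)) = \<bar>\<Sum>j=1..<m. ?T m j\<bar>" unfolding S by simp
      also have "\<dots> \<le> (\<Sum>j=1..<m. \<bar>?T m j\<bar>)" by (rule sum_abs)
      also have "\<dots> \<le> (\<Sum>j=1..<m. M * M * ((m choose j) * t ^ (j * (m - j))))"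
      proof (rule sum_mono)
        fix j
        have "\<bar>?T m j\<bar> = (\<bar>\<rho> (Suc j)\<bar> * \<bar>\<rho> (Suc (m - j))\<bar>) * ((m choose j) * t ^ (j * (m - j)))"
          by (simp add: abs_mult power_abs t_def power_one_over field_simps)
        also have "\<dots> \<le> M * M * ((m choose j) * t ^ (j * (m - j)))"
          using M M0 t_bounds by (intro mult_right_mono mult_mono) auto
        finally show "\<bar>?T m j\<bar> \<le> M * M * ((m choose j) * t ^ (j * (m - j)))" .
      qed
      also have "\<dots> = M * M * \<delta> m" unfolding \<delta>_def by (simp add: sum_distrib_left)
      finally show ?case .
    qed
    show "(\<lambda>m. M * M * \<delta> m) \<longlonglongrightarrow> 0"
      using tendsto_mult_left[OF delta_tendsto, of "M * M"] by simp
  qed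
  from tendsto_add[OF this tendsto_mult_left[OF rho_tendsto, of 2]] show ?thesis by simp
qed

end


section \<open>Necklaces of complete graphs\<close>

text \<open>Each block is an interval of \<open>d + 1\<close> vertices, and consecutive blocks share
  the multiple of \<open>d\<close> between them; the ends of the chain are \<open>0\<close> and
  \<open>N * d\<close>.\<close>

fun chain_edges :: "nat \<Rightarrow> nat \<Rightarrow> nat set set" where
  "chain_edges d 0 = {}"
| "chain_edges d (Suc N) = chain_edges d N \<union> complete_edges {N * d..Suc N * d}"

lemma chain_edges_simple: "simple_graph {0..N * d} (chain_edges d N)"
proof (induction N)
  case (Suc N)
  have "simple_graph {N * d..Suc N * d} (complete_edges {N * d..Suc N * d})"
    by (rule simple_graph_complete) simp
  moreover have "{0..N * d} \<subseteq> {0..Suc N * d}" "{N * d..Suc N * d} \<subseteq> {0..Suc N * d}" by auto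
  ultimately show ?case using Suc unfolding simple_graph_def chain_edges.simps Ball_def Un_iff
    by (meson finite_atLeastAtMost order_trans)
qed (simp add: simple_graph_def)

lemma chain_vertices_Suc:
  "{0..Suc N * d} = {0..N * d} \<union> {N * d..Suc N * d}" "{0..N * d} \<inter> {N * d..Suc N * d} = {N * d}"
  by auto

lemma chain_edges_subset: "\<Union>(chain_edges d N) \<subseteq> {0..N * d}"
  using simple_graph_edge_subset[OF chain_edges_simple] by blast

lemma complete_edges_subset: "\<Union>(complete_edges V) \<subseteq> V"
  unfolding complete_edges_def by blast

lemma chain_edges_disjoint:
  "chain_edges d N \<inter> complete_edges {N * d..Suc N * d} = {}"
proof (rule equals0I)
  fix e assume e: "e \<in> chain_edges d N \<inter> complete_edges {N * d..Suc N * d}"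
  then have "e \<subseteq> {0..N * d} \<inter> {N * d..Suc N * d}"
    using chain_edges_subset complete_edges_subset[of "{N * d..Suc N * d}"] by blast
  then have "e \<subseteq> {N * d}" using chain_vertices_Suc(2) by simp
  moreover have "card e = 2" using e unfolding complete_edges_def by simp
  ultimately show False using card_mono[of "{N * d}" e] by simp
qed

lemma finite_chain_edges: "finite (chain_edges d N)"
  by (rule finite_simple_graph[OF chain_edges_simple])

lemma finite_complete_edges: "finite V \<Longrightarrow> finite (complete_edges V)"
  by (rule finite_simple_graph[OF simple_graph_complete])

definition complete_split :: "nat \<Rightarrow> real \<Rightarrow> real" where
  "complete_split m v = (\<Sum>j\<le>m. (m choose j) * (complete_conn (Suc j) v * complete_conn (Suc m - j) v))"

lemma spanning_connected_chain: "spanning_connected {0..N * d} (chain_edges d N)"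
proof (induction N)
  case (Suc N)
  show ?case
    unfolding chain_edges.simps chain_vertices_Suc(1)[of N d]
      spanning_connected_glue[OF chain_vertices_Suc(2) chain_edges_subset complete_edges_subset]
    using Suc spanning_connected_complete by blast
qed simp

lemma conn_poly_chain:
  "conn_poly {0..N * d} (chain_edges d N) v = complete_conn (Suc d) v ^ N"
proof (induction N)
  case 0
  show ?case using conn_poly_singleton[of 0 "{}" v] by (simp add: simple_graph_def)
next
  case (Suc N)
  have "conn_poly ({0..N * d} \<union> {N * d..Suc N * d})
      (chain_edges d N \<union> complete_edges {N * d..Suc N * d}) v =
    conn_poly {0..N * d} (chain_edges d N) v *
    conn_poly {N * d..Suc N * d} (complete_edges {N * d..Suc N * d}) v"
    by (intro conn_poly_glue chain_vertices_Suc(2) chain_edges_subset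
        complete_edges_subset finite_chain_edges finite_complete_edges chain_edges_disjoint) auto
  also have "conn_poly {N * d..Suc N * d} (complete_edges {N * d..Suc N * d}) v = complete_conn (Suc d) v"
    by (subst conn_poly_complete) auto
  finally show ?case
    unfolding chain_edges.simps chain_vertices_Suc(1) Suc by simp
qed

text \<open>Exactly one of the \<open>N\<close> blocks is split between its two ends, and the others
  are connected. For \<open>N = 0\<close> the factor \<open>N\<close> makes the truncated exponent
  harmless.\<close>

lemma split_poly_chain:
  "split_poly {0..N * Suc m} (chain_edges (Suc m) N) 0 (N * Suc m) v =
     N * complete_conn (m + 2) v ^ (N - 1) * complete_split m v"
proof (induction N)
  case 0
  show ?case by (simp add: split_poly_def)
next
  case (Suc N)
  let ?d = "Suc m"
  let ?K = "{N * ?d..Suc N * ?d}"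
  have "split_poly ({0..N * ?d} \<union> ?K) (chain_edges ?d N \<union> complete_edges ?K) 0 (Suc N * ?d) v =
    conn_poly {0..N * ?d} (chain_edges ?d N) v * split_poly ?K (complete_edges ?K) (N * ?d) (Suc N * ?d) v
    + split_poly {0..N * ?d} (chain_edges ?d N) 0 (N * ?d) v * conn_poly ?K (complete_edges ?K) v"
    by (rule split_poly_glue[OF chain_vertices_Suc(2) chain_edges_subset
          complete_edges_subset finite_chain_edges finite_complete_edges
          chain_edges_disjoint]) auto
  also have "conn_poly ?K (complete_edges ?K) v = complete_conn (m + 2) v"
    by (subst conn_poly_complete) auto
  also have "split_poly ?K (complete_edges ?K) (N * ?d) (Suc N * ?d) v = complete_split m v"
    unfolding complete_split_def by (rule split_poly_complete) auto
  also have "conn_poly {0..N * ?d} (chain_edges ?d N) v = complete_conn (m + 2) v ^ N"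
    using conn_poly_chain[of N ?d v] by (simp only: add_2_eq_Suc')
  finally show ?case
    unfolding chain_edges.simps chain_vertices_Suc(1) Suc
    by (cases N) (simp_all add: algebra_simps)
qed

text \<open>With at least two blocks, none contains both ends of the chain; a single block is
  complete and would already have the edge.\<close>

lemma closing_edge_notin:
  assumes "0 < d" "2 \<le> N"
  shows "{0, N * d} \<notin> chain_edges d N"
proof -
  obtain k where N: "N = Suc k" "1 \<le> k" using assms(2) by (cases N) auto
  have "e \<subseteq> {0..k * d} \<or> e \<subseteq> {k * d..Suc k * d}" if "e \<in> chain_edges d N" for e
    using that unfolding N(1) chain_edges.simps Un_iff
    by (meson Union_upper chain_edges_subset complete_edges_subset order_trans)
  moreover have "\<not> {0, N * d} \<subseteq> {0..k * d}" "\<not> {0, N * d} \<subseteq> {k * d..Suc k * d}"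
    using assms(1) N by auto
  ultimately show ?thesis by blast
qed

lemma necklace_root:
  fixes N m :: nat and y :: real
  assumes N: "2 \<le> N" and y: "y < -1"
    and root: "y * complete_conn (m + 2) (y - 1) + (y - 1) * N * complete_split m (y - 1) = 0"
  shows "\<exists>V E. simple_graph V E \<and> connected_graph V E \<and> Rel V E (1 / y) = 0"
proof (intro exI conjI)
  let ?d = "Suc m"
  let ?V = "{0..N * ?d}"
  let ?C = "chain_edges ?d N"
  let ?E = "insert {0, N * ?d} ?C"
  have d: "0 < ?d" by simp
  have "card {0, N * ?d} = 2" using N by simp
  then show G: "simple_graph ?V ?E"
    using chain_edges_simple[of N ?d] unfolding simple_graph_def by auto
  show "connected_graph ?V ?E"
    unfolding connected_graph_def
    by (intro conjI spanning_connected_mono[OF spanning_connected_chain subset_insertI]) simp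
  let ?v = "y - 1"
  have v: "(1 - 1 / y) / (1 / y) = ?v" using y by (simp add: field_simps)
  obtain k where k: "N = Suc k" using N by (cases N) auto
  \<comment> \<open>The insertion formula with \<open>1 + v = y\<close>; the connected sums of the
    other \<open>N - 1\<close> blocks come out as a common factor.\<close>
  have "conn_poly ?V ?E ?v = complete_conn (m + 2) ?v ^ k *
      (y * complete_conn (m + 2) ?v + ?v * N * complete_split m ?v)"
    unfolding conn_poly_insert[OF finite_chain_edges closing_edge_notin[OF d N]]
      split_poly_chain conn_poly_chain
    by (simp add: k algebra_simps)
  then have "conn_poly ?V ?E ?v = 0" using root by simp
  then show "Rel ?V ?E (1 / y) = 0"
    using Rel_eq_conn_poly[OF finite_simple_graph[OF G], of "1 / y" ?V] v y by simp
qed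

section \<open>Density\<close>

text \<open>After normalisation the first term tends to \<open>- a\<close>, and the second is
  \<open>M m / a ^ m\<close> times a factor with a positive limit. So the ratio of \<open>b\<close>
  to \<open>a\<close> decides which one wins. For even \<open>m\<close> the odd power
  \<open>(- a) ^ Suc m\<close> is negative, which gives the two terms opposite signs.\<close>

lemma necklace_sign:
  fixes a b :: real and M :: "nat \<Rightarrow> nat"
  defines "f \<equiv> \<lambda>m. ((- a) * complete_conn (m + 2) (- a - 1)
      + (- a - 1) * M m * complete_split m (- a - 1)) / (- a) ^ ((m + 2) choose 2)"
  assumes a: "1 < a" and b: "1 < b" and M: "\<And>m. b ^ m \<le> M m" "\<And>m. M m \<le> b ^ m + 1"
  shows "b < a \<Longrightarrow> \<forall>\<^sub>F m in sequentially. even m \<longrightarrow> f m < 0"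
    and "a < b \<Longrightarrow> \<forall>\<^sub>F m in sequentially. even m \<longrightarrow> 0 < f m"
proof -
  define c where "c m = complete_conn (m + 2) (- a - 1) / (- a) ^ ((m + 2) choose 2)" for m
  define s where "s m = complete_split m (- a - 1) / (- a) ^ (Suc m choose 2)" for m
  have abs: "1 < \<bar>- a\<bar>" using a by simp
  have c: "c \<longlonglongrightarrow> 1"
    using LIMSEQ_ignore_initial_segment[OF complete_conn_asymptotics[OF abs], of 2]
    unfolding c_def by simp
  have s: "s \<longlonglongrightarrow> 2"
    using complete_split_asymptotics[OF abs] unfolding s_def complete_split_def .
  have f: "f m = - a * c m + (a + 1) / a * (M m / a ^ m) * s m" if "even m" for m
  proof -
    have "(m + 2) choose 2 = Suc m + (Suc m choose 2)" by (simp add: numeral_2_eq_2)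
    then have "(- a) ^ ((m + 2) choose 2) = (- a) ^ Suc m * (- a) ^ (Suc m choose 2)"
      by (simp only: power_add)
    also have "(- a) ^ Suc m = - (a ^ m * a)" using that by simp
    finally have "(- a - 1) * M m * complete_split m (- a - 1) / (- a) ^ ((m + 2) choose 2) =
        (a + 1) / a * (M m / a ^ m) * s m"
      using a unfolding s_def by (simp add: field_simps)
    then show ?thesis unfolding f_def c_def add_divide_distrib by simp
  qed
  {
    assume "b < a"
    have "(\<lambda>m. M m / a ^ m) \<longlonglongrightarrow> 0"
    proof (rule real_tendsto_sandwich[OF _ _ tendsto_const])
      show "\<forall>\<^sub>F m in sequentially. 0 \<le> M m / a ^ m" using a by simp
      have "M m / a ^ m \<le> (b / a) ^ m + (1 / a) ^ m" for m
        using M(2)[of m] a by (simp add: power_divide divide_right_mono add_divide_distrib[symmetric])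
      then show "\<forall>\<^sub>F m in sequentially. M m / a ^ m \<le> (b / a) ^ m + (1 / a) ^ m" by simp
      have "(\<lambda>m. (b / a) ^ m + (1 / a) ^ m) \<longlonglongrightarrow> 0 + 0"
        using \<open>b < a\<close> a b by (intro tendsto_add LIMSEQ_realpow_zero) auto
      then show "(\<lambda>m. (b / a) ^ m + (1 / a) ^ m) \<longlonglongrightarrow> 0" by simp
    qed
    then have "(\<lambda>m. - a * c m + (a + 1) / a * (M m / a ^ m) * s m) \<longlonglongrightarrow> - a * 1 + (a + 1) / a * 0 * 2"
      by (intro tendsto_intros c s)
    from order_tendstoD(2)[OF this, of 0] a
    show "\<forall>\<^sub>F m in sequentially. even m \<longrightarrow> f m < 0"
      by (simp add: f eventually_mono)
  }
  {
    assume "a < b"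
    have ba: "1 < b / a" using \<open>a < b\<close> a by simp
    \<comment> \<open>The threshold \<open>2 * a\<close> beats the first term, since
      \<open>c m < 2\<close> eventually, while the factors \<open>(a + 1) / a\<close> and
      \<open>s m\<close> exceed 1.\<close>
    then obtain n where n: "2 * a < (b / a) ^ n" using real_arch_pow by blast
    have "\<forall>\<^sub>F m in sequentially. 2 * a < (b / a) ^ m"
      using eventually_ge_at_top[of n]
    proof eventually_elim
      case (elim m)
      then have "(b / a) ^ n \<le> (b / a) ^ m" using ba by (intro power_increasing) auto
      with n show ?case by simp
    qed
    moreover have "\<forall>\<^sub>F m in sequentially. c m < 2" "\<forall>\<^sub>F m in sequentially. 1 < s m"
      using order_tendstoD(2)[OF c, of 2] order_tendstoD(1)[OF s, of 1] by auto
    ultimately show "\<forall>\<^sub>F m in sequentially. even m \<longrightarrow> 0 < f m"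
    proof eventually_elim
      case (elim m)
      have "2 * a < M m / a ^ m"
        using elim(1) M(1)[of m] a by (simp add: power_divide field_simps)
      moreover have "1 < (a + 1) / a" using a by simp
      ultimately have "2 * a < (a + 1) / a * (M m / a ^ m)"
        using a by (smt (verit) mult_less_cancel_right1 mult_less_cancel_right2)
      also have "\<dots> \<le> (a + 1) / a * (M m / a ^ m) * s m"
        using mult_left_mono[of 1 "s m" "(a + 1) / a * (M m / a ^ m)"] elim(3) a by simp
      finally have "2 * a < (a + 1) / a * (M m / a ^ m) * s m" .
      moreover have "a * c m < 2 * a" using elim(2) a by simp
      ultimately show ?case using f[of m] by simp
    qed
  }
qed

text \<open>With about \<open>b ^ m\<close> blocks for some \<open>b\<close> strictly between
  \<open>a2\<close> and \<open>a1\<close>, the normalised factor has opposite signs at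
  \<open>- a1\<close> and \<open>- a2\<close> for large even \<open>m\<close>, and the intermediate
  value theorem gives a root.\<close>

lemma necklace_root_between:
  assumes a: "1 < a2" "a2 < a1"
  shows "\<exists>y\<in>{- a1..- a2}. \<exists>V E. simple_graph V E \<and> connected_graph V E \<and> Rel V E (1 / y) = 0"
proof -
  obtain b where b: "a2 < b" "b < a1" using dense[OF a(2)] by blast
  define M where "M m = nat \<lceil>b ^ m\<rceil>" for m
  have b1: "1 < b" using a b by simp
  have M: "b ^ m \<le> M m" "M m \<le> b ^ m + 1" for m
    using b1 of_int_ceiling_le_add_one[of "b ^ m"] by (auto simp: M_def)
  have a1: "1 < a1" using a by simp
  let ?f = "\<lambda>a m. ((- a) * complete_conn (m + 2) (- a - 1)
      + (- a - 1) * M m * complete_split m (- a - 1)) / (- a) ^ ((m + 2) choose 2)"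
  have "\<forall>\<^sub>F m in sequentially. 1 < b ^ m"
    using eventually_gt_at_top[of 0] by eventually_elim (use b1 in simp)
  then have "\<forall>\<^sub>F m in sequentially. even m \<longrightarrow> ?f a1 m < 0 \<and> 0 < ?f a2 m \<and> 1 < b ^ m"
    using necklace_sign(1)[OF a1 b1 M b(2)] necklace_sign(2)[OF a(1) b1 M b(1)]
    by eventually_elim blast
  then obtain m0 where m0: "\<And>m. m \<ge> m0 \<Longrightarrow> even m \<Longrightarrow> ?f a1 m < 0 \<and> 0 < ?f a2 m \<and> 1 < b ^ m"
    unfolding eventually_sequentially by blast
  define m where "m = 2 * m0"
  let ?K = "(m + 2) choose 2"
  define F where "F y = y * complete_conn (m + 2) (y - 1) + (y - 1) * M m * complete_split m (y - 1)" for y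
  have m: "F (- a1) / (- a1) ^ ?K < 0" "0 < F (- a2) / (- a2) ^ ?K" "1 < b ^ m"
    using m0[of m] unfolding F_def by (auto simp: m_def)
  \<comment> \<open>Two blocks are required for the closing edge to be new; this is why
    \<open>1 < b ^ m\<close> was carried along.\<close>
  have M2: "2 \<le> M m" using m(3) M(1)[of m] by linarith
  have cont: "continuous_on {- a1..- a2} F"
    unfolding F_def complete_split_def complete_conn_def
    by (intro continuous_intros continuous_conn_poly)
  have "\<exists>y\<in>{- a1..- a2}. F y = 0"
  \<comment> \<open>Removing the normalisation flips both signs or neither, as the exponent
    \<open>?K\<close> is the same at both ends; the sign change survives in either case.\<close>
  proof (cases "even ?K")
    case True
    then have "F (- a1) < 0" "0 < F (- a2)" using m(1,2) a
      by (auto simp: divide_less_0_iff zero_less_divide_iff)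
    then show ?thesis using IVT'[of F "- a1" 0 "- a2", OF _ _ _ cont] a by force
  next
    case False
    then have "0 < F (- a1)" "F (- a2) < 0" using m(1,2) a
      by (auto simp: divide_less_0_iff zero_less_divide_iff)
    then show ?thesis using IVT2'[of F "- a2" 0 "- a1", OF _ _ _ cont] a by force
  qed
  then obtain y where y: "y \<in> {- a1..- a2}" "F y = 0" by blast
  have "\<exists>V E. simple_graph V E \<and> connected_graph V E \<and> Rel V E (1 / y) = 0"
    using y a by (intro necklace_root[OF M2, of y m]) (auto simp: F_def)
  with y(1) show ?thesis by blast
qed

text \<open>A single edge has reliability \<open>1 - q\<close>.\<close>

lemma root_at_1: "\<exists>V E. simple_graph V E \<and> connected_graph V E \<and> Rel V E 1 = 0"
proof (intro exI conjI)
  let ?V = "{0, 1} :: nat set" and ?E = "{{0, 1}} :: nat set set"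
  show "simple_graph ?V ?E" by (simp add: simple_graph_def)
  have n: "\<not> spanning_connected ?V {}" by (simp add: spanning_connected_def)
  have "(0, 1) \<in> {(x, y). {x, y} \<in> ?E}\<^sup>*" "(1, 0) \<in> {(x, y). {x, y} \<in> ?E}\<^sup>*"
    by (auto intro!: r_into_rtrancl)
  then show c: "connected_graph ?V ?E"
    unfolding connected_graph_def spanning_connected_def by auto
  have "{A. A \<subseteq> ?E \<and> spanning_connected ?V A} = {?E}"
    using n c unfolding connected_graph_def by (auto simp: subset_singleton_iff)
  then show "Rel ?V ?E 1 = 0" unfolding Rel_def by simp
qed

theorem theorem1p1:
  shows "closure {q :: real. \<exists>V E. simple_graph V E \<and> connected_graph V E \<and> Rel V E q = 0}
         = {-1..0} \<union> {1}"
proof (rule antisym)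
  let ?R = "{q :: real. \<exists>V E. simple_graph V E \<and> connected_graph V E \<and> Rel V E q = 0}"
  show "closure ?R \<subseteq> {-1..0} \<union> {1}"
    by (rule closure_minimal) (use Rel_root_bounds in blast, simp)
  have "q \<in> closure ?R" if q: "-1 \<le> q" "q \<le> 0" for q
    unfolding closure_approachable
  proof (intro allI impI)
    fix e :: real assume e: "0 < e"
    \<comment> \<open>An interval inside both the \<open>e\<close>-neighbourhood of \<open>q\<close>
      and the open interval from -1 to 0; choosing it strictly inside also covers the endpoints
      \<open>q = -1\<close> and \<open>q = 0\<close>.\<close>
    obtain q1 q2 where q12: "-1 < q1" "q1 < q2" "q2 < 0" "q - e < q1" "q2 < q + e"
    proof -
      have "max (-1) (q - e) < min 0 (q + e)" using q e by auto
      then obtain q1 where q1: "max (-1) (q - e) < q1" "q1 < min 0 (q + e)" using dense by blast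
      then obtain q2 where "q1 < q2" "q2 < min 0 (q + e)" using dense by blast
      with q1 show ?thesis by (intro that[of q1 q2]) auto
    qed
    \<comment> \<open>Reciprocals reverse the order on the negative axis, so \<open>- 1 / q1\<close>
      plays the part of \<open>a2\<close> and \<open>- 1 / q2\<close> that of
      \<open>a1\<close>.\<close>
    have "1 < - 1 / q1" "- 1 / q1 < - 1 / q2"
      using q12 by (simp_all add: field_simps)
    from necklace_root_between[OF this] obtain y V E where
      y: "y \<in> {1 / q2..1 / q1}" and G: "simple_graph V E" "connected_graph V E" "Rel V E (1 / y) = 0"
      by auto
    have "y < 0" using y q12 by (smt (verit) atLeastAtMost_iff divide_less_0_1_iff)
    then have "q1 \<le> 1 / y" "1 / y \<le> q2" using y q12 by (auto simp: field_simps)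
    then have "dist (1 / y) q < e" using q12 by (auto simp: dist_real_def)
    with G show "\<exists>z\<in>?R. dist z q < e" by blast
  qed
  moreover have "1 \<in> closure ?R" using root_at_1 closure_subset[of ?R] by blast
  ultimately show "{-1..0} \<union> {1} \<subseteq> closure ?R" by auto
qed

end
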